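(* In types $E_6^{(2)}$ and $F_4^{(1)}$ every reduced Young wall satisfies the right block property: if the wall contains a block, then it contains the block occupying the same position in the column immediately to the right (that is, for every $k\geq 0$ and every block of the wall in column $k+1$, the block in the same position in column $k$ belongs to the wall).
   Context: **Young column patterns.** $I=\{0,1,2,3,4\}$ is the set of colors. A pattern is an infinite vertical stack of colored blocks arranged in rows indexed by $\mathbb Z$ from bottom to top. It is invariant under the shift by four rows combined with the $180^\circ$ rotation around the vertical axis; this symmetry $\sigma$ sends a block with index $m$ to the block with the same letter and index $m+1$. "$x$ on $y$" means block $x$ rests on block $y$ (so $y$ must be present for there to be no empty space below $x$); $i$-block means a block of color $i$. *Type $E_6^{(2)}$*, for every $m\in\mathbb Z$: row $4m$: $c_m$ (color 3), $a_m$ (color 1); row $4m+1$: $b_m,b'_m$ (color 2); row $4m+2$: $a'_m$ (color 1), $c'_m$ (color 3); row $4m+3$: $z_m$ (color 0), $b''_m$ (color 2), $d_m$ (color 4). Support: $b_m$ on $c_m$; $b'_m$ on $c_m,a_m$; $a'_m$ on $b_m$; $c'_m$ on $b_m,b'_m$; $z_m$ on $a'_m$; $b''_m$ on $a'_m,c'_m$; $d_m$ on $c'_m$; $a_{m+1}$ on $z_m,b''_m$; $c_{m+1}$ on $b''_m,d_m$. *Type $F_4^{(1)}$*, for every $m\in\mathbb Z$: row $4m$: $c^1_m$ (color 3), $d^1_m$ (color 4), $a^1_m$ (color 1); row $4m+1$: $c^2_m$ (color 3), $b^1_m$ (color 2); row $4m+2$: $b^2_m$ (color 2), $c^3_m$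 (color 3); row $4m+3$ (a double-height row): $a^2_m$ (color 1), $c^4_m$ (color 3), $d^2_m$ (color 4), $z_m$ (color 0), $b^3_m$ (color 2). Support: $c^2_m$ on $c^1_m,d^1_m$; $b^1_m$ on $c^1_m,a^1_m$; $b^2_m$ on $c^2_m$; $c^3_m$ on $b^1_m$; $a^2_m$ on $b^2_m$; $c^4_m$ on $b^2_m,c^3_m$; $d^2_m$ on $c^3_m$; $z_m$ on $a^2_m$; $b^3_m$ on $a^2_m,c^4_m$; $c^1_{m+1}$ on $b^3_m,c^4_m,d^2_m$; $d^1_{m+1}$ on $c^4_m,d^2_m$; $a^1_{m+1}$ on $z_m,b^3_m$. **Young columns.** A pre-Young column is a nonempty set of blocks of the pattern whose height is bounded above and which contains, with any block, all blocks it rests on. A block of it is free if removing it leaves a pre-Young column. A pre-Young column is exceptional if its highest nonempty row contains precisely one free $2$-block and the column contains a free $1$-block (up to $\sigma$ the only one is: all blocks of index $\le0$ together with $a_1,c_1,b_1$ in type $E_6^{(2)}$, and with $c^1_1,d^1_1,a^1_1,c^2_1,b^2_1$ in type $F_4^{(1)}$). A Young column is a non-exceptional pre-Young column. Two Young columns are equivalent if they are related by vertical shift and $180^\circ$ rotation, i.e. by a power of $\sigma$. Let $C$ (resp. $C'$) be the set of equivalence classes in type $E_6^{(2)}$ (resp. $F_4^{(1)}$). Some classes have names. *Type $E_6^{(2)}$:* let $D$ be the set of all blocks of index $\le-1$ and $c_0,a_0,b_0,b'_0,a'_0,c'_0,b''_0$; $y_\emptyset$ is the class of $D\cup\{d_0,c_1,b_1,a'_1,z_1\}$,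 $y_{r_1}$ of $D\cup\{z_0,d_0,c_1,b_1,a'_1\}$, $y_{r_2}$ of $D\cup\{z_0,a_1,b'_1,d_0,c_1\}$. *Type $F_4^{(1)}$:* let $D$ be the set of all blocks of index $\le-1$ and all blocks of index $0$ except $z_0,d^2_0$; $y_\emptyset$ is the class of $D\cup\{d^2_0,c^1_1,d^1_1,c^2_1,b^2_1,a^2_1,z_1\}$, $y_{r_1}$ of $D\cup\{z_0,d^2_0,c^1_1,d^1_1,c^2_1,b^2_1,a^2_1\}$, $y_{r_2}$ of $D\cup\{z_0,a^1_1,b^1_1,d^2_0,c^1_1,d^1_1,c^2_1\}$, $y_{r_3}$ of $D\cup\{z_0,a^1_1,b^1_1,c^3_1,d^2_0,c^1_1,d^1_1\}$, $y_{r_4}$ of $D\cup\{z_0,a^1_1,b^1_1,c^3_1,d^2_1,d^2_0,c^1_1\}$. **Crystal operators on Young columns.** An $i$-block in a Young column $y$ is removable if removing it gives a Young column; an $i$-block of the pattern not in $y$ is addable if adding it gives a Young column. $\tilde f_i$ adds an addable $i$-block if one exists (the higher one if there are two), else gives $0$; moreover $\tilde f_i(y)=0$ if $y\in y_{r_j}$, $j\ne i$. $\tilde e_i$ removes a removable $i$-block if one exists (the lower one if there are two), else gives $0$; moreover $\tilde e_i(y)=0$ if $y\in y_{r_j}$, $j\neq i$. $\varphi_i(y)=\max\{n:\tilde f_i^ny\ne0\}$, $\varepsilon_i(y)=\max\{n:\tilde e_i^ny\neq0\}$. These descend to $C$ and $C'$, making them classical crystals isomorphic to level $1$ perfect crystals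 of $U_q(E_6^{(2)})$ and $U_q(F_4^{(1)})$. **Energy function.** On tensor products, $\tilde f_i(a\otimes b)=\tilde f_ia\otimes b$ if $\varphi_i(a)>\varepsilon_i(b)$ and $a\otimes\tilde f_ib$ if $\varphi_i(a)\le\varepsilon_i(b)$. $H:C\otimes C\to\mathbb Z$ (resp. $H':C'\otimes C'\to\mathbb Z$) is the unique function with value $0$ at $y_\emptyset\otimes y_\emptyset$ such that, whenever $\tilde f_i(a\otimes b)\neq0$, $H(\tilde f_i(a\otimes b))-H(a\otimes b)$ equals $0$ if $i\ne0$, $-1$ if $i=0$ and $\varphi_0(a)>\varepsilon_0(b)$, and $+1$ if $i=0$ and $\varphi_0(a)\le\varepsilon_0(b)$ (and likewise for $H'$). **Young walls.** The Young wall pattern consists of copies of the Young column pattern, all at the same height and orientation, placed in columns $k=0,1,2,\dots$ from right to left; blocks in different columns occupy the same position if they are the same block of the Young column pattern. Fix a Young column $g\in y_\emptyset$ (the ground-state column); the ground-state wall has $g$ in every column. A Young wall $Y=(\dots,y_2,y_1,y_0)$ is a set of blocks in the Young wall pattern differing from the ground-state wall in finitely many blocks and such that each column $y_k$ is a Young column. $|y_k|_0$ is the number of $0$-blocks in $y_k\setminus g$ minus that in $g\setminus y_k$. A Young wall is reduced if for all $k\ge0$ one has $H(y_{k+1}\otimes y_k)+|y_{k+1}|_0-|y_k|_0=0$ (with $H'$ in place of $H$ in type $F_4^{(1)}$; classes of columns are inserted in $H,H'$). *)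

theory Defs
  imports Main
begin

section \<open>Patterns and columns\<close>

text \<open>
  A block is a letter together with its index \<open>m\<close>.  A pattern is invariant under the symmetry
  raising all indices by one, so it is given by data on letters: a block \<open>(l, m)\<close> lies in row
  \<open>4 * m + level l\<close> and rests on the blocks \<open>(l', m + s)\<close> with \<open>(l', s) \<in> below l\<close>.  The
  last two fields hold representatives of the named classes: \<open>empty_rep\<close> of \<open>y\<^sub>\<emptyset>\<close> and
  \<open>r_rep j\<close> of \<open>y\<^bsub>r\<^sub>j\<^esub>\<close>, where \<open>r_rep j = None\<close> if there is no class with that name.
\<close>

type_synonym 'l block = "'l \<times> int"

record 'l pattern =
  color :: "'l \<Rightarrow> nat"
  level :: "'l \<Rightarrow> int"
  below :: "'l \<Rightarrow> ('l \<times> int) set"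
  empty_rep :: "('l \<times> int) set"
  r_rep :: "nat \<Rightarrow> ('l \<times> int) set option"

definition block_color :: "'l pattern \<Rightarrow> 'l block \<Rightarrow> nat" where
  "block_color P x = color P (fst x)"

definition row :: "'l pattern \<Rightarrow> 'l block \<Rightarrow> int" where
  "row P x = 4 * snd x + level P (fst x)"

definition rests_on :: "'l pattern \<Rightarrow> 'l block \<Rightarrow> 'l block \<Rightarrow> bool" where
  "rests_on P x x' \<longleftrightarrow> (fst x', snd x' - snd x) \<in> below P (fst x)"

definition pre_young :: "'l pattern \<Rightarrow> 'l block set \<Rightarrow> bool" where
  "pre_young P y \<longleftrightarrow>
     y \<noteq> {} \<and> (\<exists>r. \<forall>x\<in>y. row P x \<le> r) \<and> (\<forall>x\<in>y. \<forall>x'. rests_on P x x' \<longrightarrow> x' \<in> y)"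

definition free_block :: "'l pattern \<Rightarrow> 'l block set \<Rightarrow> 'l block \<Rightarrow> bool" where
  "free_block P y x \<longleftrightarrow> x \<in> y \<and> pre_young P (y - {x})"

definition exceptional :: "'l pattern \<Rightarrow> 'l block set \<Rightarrow> bool" where
  "exceptional P y \<longleftrightarrow> pre_young P y \<and>
     (\<exists>r. (\<exists>x\<in>y. row P x = r) \<and> (\<forall>x\<in>y. row P x \<le> r) \<and>
        (\<exists>!x. free_block P y x \<and> block_color P x = 2 \<and> row P x = r)) \<and>
     (\<exists>x. free_block P y x \<and> block_color P x = 1)"

definition young :: "'l pattern \<Rightarrow> 'l block set \<Rightarrow> bool" where
  "young P y \<longleftrightarrow> pre_young P y \<and> \<not> exceptional P y"

text \<open>\<open>shift n\<close> is the \<open>n\<close>-th power of the symmetry of the pattern.\<close>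

definition shift :: "int \<Rightarrow> 'l block \<Rightarrow> 'l block" where
  "shift n x = (fst x, snd x + n)"

definition column_equiv :: "'l pattern \<Rightarrow> ('l block set \<times> 'l block set) set" where
  "column_equiv P = {(y, y'). young P y \<and> young P y' \<and> (\<exists>n. y' = shift n ` y)}"

definition column_class :: "'l pattern \<Rightarrow> 'l block set \<Rightarrow> 'l block set set" where
  "column_class P y = column_equiv P `` {y}"

definition column_classes :: "'l pattern \<Rightarrow> 'l block set set set" where
  "column_classes P = {y. young P y} // column_equiv P"

definition y_empty :: "'l pattern \<Rightarrow> 'l block set set" where
  "y_empty P = column_class P (empty_rep P)"

definition y_r :: "'l pattern \<Rightarrow> nat \<Rightarrow> 'l block set set" where
  "y_r P j = (case r_rep P j of None \<Rightarrow> {} | Some y \<Rightarrow> column_class P y)"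


section \<open>Crystal operators\<close>

definition removable :: "'l pattern \<Rightarrow> nat \<Rightarrow> 'l block set \<Rightarrow> 'l block \<Rightarrow> bool" where
  "removable P i y x \<longleftrightarrow> x \<in> y \<and> block_color P x = i \<and> young P (y - {x})"

definition addable :: "'l pattern \<Rightarrow> nat \<Rightarrow> 'l block set \<Rightarrow> 'l block \<Rightarrow> bool" where
  "addable P i y x \<longleftrightarrow> x \<notin> y \<and> block_color P x = i \<and> young P (insert x y)"

text \<open>The value \<open>0\<close> of a crystal operator is represented by \<open>None\<close>.\<close>

definition f_op :: "'l pattern \<Rightarrow> nat \<Rightarrow> 'l block set \<Rightarrow> 'l block set option" where
  "f_op P i y =
     (if (\<exists>x. addable P i y x) \<and> \<not> (\<exists>j. j \<noteq> i \<and> y \<in> y_r P j)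
      then Some (insert (arg_max (row P) (addable P i y)) y) else None)"

definition e_op :: "'l pattern \<Rightarrow> nat \<Rightarrow> 'l block set \<Rightarrow> 'l block set option" where
  "e_op P i y =
     (if (\<exists>x. removable P i y x) \<and> \<not> (\<exists>j. j \<noteq> i \<and> y \<in> y_r P j)
      then Some (y - {arg_min (row P) (removable P i y)}) else None)"

definition op_power :: "('a \<Rightarrow> 'a option) \<Rightarrow> nat \<Rightarrow> 'a \<Rightarrow> 'a option" where
  "op_power g n y = ((\<lambda>z. Option.bind z g) ^^ n) (Some y)"

definition \<phi> :: "'l pattern \<Rightarrow> nat \<Rightarrow> 'l block set \<Rightarrow> nat" where
  "\<phi> P i y = Max {n. op_power (f_op P i) n y \<noteq> None}"

definition \<epsilon> :: "'l pattern \<Rightarrow> nat \<Rightarrow> 'l block set \<Rightarrow> nat" where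
  "\<epsilon> P i y = Max {n. op_power (e_op P i) n y \<noteq> None}"

text \<open>
  The induced maps on equivalence classes: the image of a class under a map that is constant on it
  is a singleton.
\<close>

definition f_class :: "'l pattern \<Rightarrow> nat \<Rightarrow> 'l block set set \<Rightarrow> 'l block set set option" where
  "f_class P i X = the_elem ((\<lambda>y. map_option (column_class P) (f_op P i y)) ` X)"

definition \<phi>_class :: "'l pattern \<Rightarrow> nat \<Rightarrow> 'l block set set \<Rightarrow> nat" where
  "\<phi>_class P i X = the_elem (\<phi> P i ` X)"

definition \<epsilon>_class :: "'l pattern \<Rightarrow> nat \<Rightarrow> 'l block set set \<Rightarrow> nat" where
  "\<epsilon>_class P i X = the_elem (\<epsilon> P i ` X)"

text \<open>The pair \<open>(a, b)\<close> stands for \<open>a \<otimes> b\<close>.\<close>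

definition f_tensor ::
  "'l pattern \<Rightarrow> nat \<Rightarrow> 'l block set set \<times> 'l block set set
     \<Rightarrow> ('l block set set \<times> 'l block set set) option" where
  "f_tensor P i = (\<lambda>(a, b).
     if \<phi>_class P i a > \<epsilon>_class P i b
     then map_option (\<lambda>a'. (a', b)) (f_class P i a)
     else map_option (\<lambda>b'. (a, b')) (f_class P i b))"

text \<open>
  The conditions determine \<open>H\<close> on pairs of classes of Young columns; its values on other pairs
  are irrelevant.
\<close>

definition energy_function ::
  "'l pattern \<Rightarrow> ('l block set set \<times> 'l block set set \<Rightarrow> int) \<Rightarrow> bool" where
  "energy_function P H \<longleftrightarrow>
     H (y_empty P, y_empty P) = 0 \<and>
     (\<forall>i\<in>{0..4}. \<forall>a\<in>column_classes P. \<forall>b\<in>column_classes P. \<forall>t.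
        f_tensor P i (a, b) = Some t \<longrightarrow>
        H t - H (a, b) =
          (if i \<noteq> 0 then 0 else if \<phi>_class P 0 a > \<epsilon>_class P 0 b then - 1 else 1))"


section \<open>Young walls\<close>

text \<open>
  A wall is a set of pairs \<open>(k, x)\<close>, the block \<open>x\<close> placed in column \<open>k\<close>; columns are numbered
  from right to left.  Column \<open>k\<close> of a wall \<open>Y\<close> is thus \<open>Y `` {k}\<close>.
\<close>

definition young_wall :: "'l pattern \<Rightarrow> 'l block set \<Rightarrow> (nat \<times> 'l block) set \<Rightarrow> bool" where
  "young_wall P g Y \<longleftrightarrow>
     finite ((Y - UNIV \<times> g) \<union> (UNIV \<times> g - Y)) \<and> (\<forall>k. young P (Y `` {k}))"

definition zero_count :: "'l pattern \<Rightarrow> 'l block set \<Rightarrow> 'l block set \<Rightarrow> int" where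
  "zero_count P g y =
     int (card {x \<in> y - g. block_color P x = 0}) - int (card {x \<in> g - y. block_color P x = 0})"

definition reduced ::
  "'l pattern \<Rightarrow> ('l block set set \<times> 'l block set set \<Rightarrow> int) \<Rightarrow> 'l block set
     \<Rightarrow> (nat \<times> 'l block) set \<Rightarrow> bool" where
  "reduced P H g Y \<longleftrightarrow> (\<forall>k.
     H (column_class P (Y `` {Suc k}), column_class P (Y `` {k}))
       + zero_count P g (Y `` {Suc k}) - zero_count P g (Y `` {k}) = 0)"

definition right_block_property :: "(nat \<times> 'l block) set \<Rightarrow> bool" where
  "right_block_property Y \<longleftrightarrow> (\<forall>k x. (Suc k, x) \<in> Y \<longrightarrow> (k, x) \<in> Y)"


section \<open>The pattern of type \<open>E\<^sub>6\<^sup>(\<^sup>2\<^sup>)\<close>\<close>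

datatype e6_letter = Ec | Ea | Eb | Eb' | Ea' | Ec' | Ez | Eb'' | Ed

fun e6_color :: "e6_letter \<Rightarrow> nat" where
  "e6_color Ez = 0"
| "e6_color Ea = 1"
| "e6_color Ea' = 1"
| "e6_color Eb = 2"
| "e6_color Eb' = 2"
| "e6_color Eb'' = 2"
| "e6_color Ec = 3"
| "e6_color Ec' = 3"
| "e6_color Ed = 4"

fun e6_level :: "e6_letter \<Rightarrow> int" where
  "e6_level Ec = 0"
| "e6_level Ea = 0"
| "e6_level Eb = 1"
| "e6_level Eb' = 1"
| "e6_level Ea' = 2"
| "e6_level Ec' = 2"
| "e6_level Ez = 3"
| "e6_level Eb'' = 3"
| "e6_level Ed = 3"

fun e6_below :: "e6_letter \<Rightarrow> (e6_letter \<times> int) set" where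
  "e6_below Eb = {(Ec, 0)}"
| "e6_below Eb' = {(Ec, 0), (Ea, 0)}"
| "e6_below Ea' = {(Eb, 0)}"
| "e6_below Ec' = {(Eb, 0), (Eb', 0)}"
| "e6_below Ez = {(Ea', 0)}"
| "e6_below Eb'' = {(Ea', 0), (Ec', 0)}"
| "e6_below Ed = {(Ec', 0)}"
| "e6_below Ea = {(Ez, - 1), (Eb'', - 1)}"
| "e6_below Ec = {(Eb'', - 1), (Ed, - 1)}"

definition e6_D :: "e6_letter block set" where
  "e6_D = {x. snd x \<le> - 1} \<union>
     {(Ec, 0), (Ea, 0), (Eb, 0), (Eb', 0), (Ea', 0), (Ec', 0), (Eb'', 0)}"

definition e6_pattern :: "e6_letter pattern" where
  "e6_pattern = \<lparr>
     color = e6_color,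
     level = e6_level,
     below = e6_below,
     empty_rep = e6_D \<union> {(Ed, 0), (Ec, 1), (Eb, 1), (Ea', 1), (Ez, 1)},
     r_rep = [1 \<mapsto> e6_D \<union> {(Ez, 0), (Ed, 0), (Ec, 1), (Eb, 1), (Ea', 1)},
              2 \<mapsto> e6_D \<union> {(Ez, 0), (Ea, 1), (Eb', 1), (Ed, 0), (Ec, 1)}]\<rparr>"


section \<open>The pattern of type \<open>F\<^sub>4\<^sup>(\<^sup>1\<^sup>)\<close>\<close>

datatype f4_letter = Fc1 | Fd1 | Fa1 | Fc2 | Fb1 | Fb2 | Fc3 | Fa2 | Fc4 | Fd2 | Fz | Fb3

fun f4_color :: "f4_letter \<Rightarrow> nat" where
  "f4_color Fz = 0"
| "f4_color Fa1 = 1"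
| "f4_color Fa2 = 1"
| "f4_color Fb1 = 2"
| "f4_color Fb2 = 2"
| "f4_color Fb3 = 2"
| "f4_color Fc1 = 3"
| "f4_color Fc2 = 3"
| "f4_color Fc3 = 3"
| "f4_color Fc4 = 3"
| "f4_color Fd1 = 4"
| "f4_color Fd2 = 4"

text \<open>The double-height row counts as a single row.\<close>

fun f4_level :: "f4_letter \<Rightarrow> int" where
  "f4_level Fc1 = 0"
| "f4_level Fd1 = 0"
| "f4_level Fa1 = 0"
| "f4_level Fc2 = 1"
| "f4_level Fb1 = 1"
| "f4_level Fb2 = 2"
| "f4_level Fc3 = 2"
| "f4_level Fa2 = 3"
| "f4_level Fc4 = 3"
| "f4_level Fd2 = 3"
| "f4_level Fz = 3"
| "f4_level Fb3 = 3"

fun f4_below :: "f4_letter \<Rightarrow> (f4_letter \<times> int) set" where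
  "f4_below Fc2 = {(Fc1, 0), (Fd1, 0)}"
| "f4_below Fb1 = {(Fc1, 0), (Fa1, 0)}"
| "f4_below Fb2 = {(Fc2, 0)}"
| "f4_below Fc3 = {(Fb1, 0)}"
| "f4_below Fa2 = {(Fb2, 0)}"
| "f4_below Fc4 = {(Fb2, 0), (Fc3, 0)}"
| "f4_below Fd2 = {(Fc3, 0)}"
| "f4_below Fz = {(Fa2, 0)}"
| "f4_below Fb3 = {(Fa2, 0), (Fc4, 0)}"
| "f4_below Fc1 = {(Fb3, - 1), (Fc4, - 1), (Fd2, - 1)}"
| "f4_below Fd1 = {(Fc4, - 1), (Fd2, - 1)}"
| "f4_below Fa1 = {(Fz, - 1), (Fb3, - 1)}"

definition f4_D :: "f4_letter block set" where
  "f4_D = {x. snd x \<le> - 1} \<union> {x. snd x = 0 \<and> fst x \<noteq> Fz \<and> fst x \<noteq> Fd2}"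

definition f4_pattern :: "f4_letter pattern" where
  "f4_pattern = \<lparr>
     color = f4_color,
     level = f4_level,
     below = f4_below,
     empty_rep = f4_D \<union> {(Fd2, 0), (Fc1, 1), (Fd1, 1), (Fc2, 1), (Fb2, 1), (Fa2, 1), (Fz, 1)},
     r_rep =
       [1 \<mapsto> f4_D \<union> {(Fz, 0), (Fd2, 0), (Fc1, 1), (Fd1, 1), (Fc2, 1), (Fb2, 1), (Fa2, 1)},
        2 \<mapsto> f4_D \<union> {(Fz, 0), (Fa1, 1), (Fb1, 1), (Fd2, 0), (Fc1, 1), (Fd1, 1), (Fc2, 1)},
        3 \<mapsto> f4_D \<union> {(Fz, 0), (Fa1, 1), (Fb1, 1), (Fc3, 1), (Fd2, 0), (Fc1, 1), (Fd1, 1)},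
        4 \<mapsto> f4_D \<union> {(Fz, 0), (Fa1, 1), (Fb1, 1), (Fc3, 1), (Fd2, 1), (Fd2, 0), (Fc1, 1)}]\<rparr>"

end

theory Submission
  imports Defs
begin

text \<open>
  Up to the symmetry of the pattern there are only 27 Young columns in type \<open>E\<^sub>6\<^sup>(\<^sup>2\<^sup>)\<close> and 53 in type
  \<open>F\<^sub>4\<^sup>(\<^sup>1\<^sup>)\<close>.  For two columns \<open>a\<close> and \<open>b\<close> the integer \<open>H(a \<otimes> b) + |a|\<^sub>0 - |b|\<^sub>0\<close> does not change when a crystal
  operator is applied to \<open>a \<otimes> b\<close>, and it vanishes if both columns are the ground-state column.
  Applying operators \<open>f\<^sub>i\<close>, those with \<open>i \<noteq> 0\<close> as long as possible, one
  arrives at two columns of the class \<open>y\<^sub>\<emptyset>\<close>, whose distance is the value of the invariant.  Hence the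
  wall is reduced if and only if the distance of neighbouring columns has the value found in this way,
  and in each of the finitely many cases the left column is then contained in the right one.
\<close>

section \<open>Codes of columns\<close>

text \<open>The energy function is known only through its increments along crystal operators, so its
  value at a pair must be found along a path to the pair where it is normalized. That every pair has
  such a path is connectedness of the tensor square, which is verified case by case. Color 0 cannot
  be avoided: all operators of the other colors vanish on \<open>y_empty\<close>, so this class is
  entered by color 0 only. The numbers are 27 = 26 + 1 and 53 = 52 + 1: the crystals of the two
  smallest nontrivial representations of finite type F4, each with a trivial component formed by
  \<open>y_empty\<close>.

  The definitions speak of infinite sets and use \<open>Max\<close>, \<open>arg_max\<close> and
  \<open>the_elem\<close>, so they cannot be evaluated directly. The locales prove once that codes
  compute them, under hypotheses that are decidable statements about lists; evaluation then
  discharges these for both types. Codes forget the height, hence the shift of each factor is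
  tracked along a path.\<close>

text \<open>
  A pre-Young column with a block of index \<open>m\<close> contains every block of index at most \<open>m - 2\<close>
  (\<open>full_below\<close> below).  So it consists of all blocks of index less than some \<open>n\<close> and some blocks of
  indices \<open>n\<close> and \<open>n + 1\<close>, whose letters are listed in a code \<open>(A, B)\<close>; choosing \<open>n\<close> such that
  not all letters are in \<open>A\<close> makes the code unique.
\<close>

type_synonym 'l code = "'l list \<times> 'l list"

fun col :: "int \<Rightarrow> 'l code \<Rightarrow> 'l block set" where
  "col n (A, B) = {x. snd x < n \<or> snd x = n \<and> fst x \<in> set A \<or> snd x = n + 1 \<and> fst x \<in> set B}"

definition place :: "int \<Rightarrow> 'l block \<Rightarrow> 'l block" where
  "place n p = (fst p, n + snd p)"

text \<open>The number of times \<open>g\<close> can be iterated, cut off at \<open>k\<close>; a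
  value below \<open>k\<close> is therefore exact. All strings in the two crystals have length at
  most 2, so the fuel 4 used below is ample.\<close>

fun len :: "('c \<Rightarrow> ('c \<times> int) option) \<Rightarrow> nat \<Rightarrow> 'c \<Rightarrow> nat" where
  "len g 0 c = 0"
| "len g (Suc k) c = (case g c of None \<Rightarrow> 0 | Some (c', _) \<Rightarrow> Suc (len g k c'))"

text \<open>
  The checks below are evaluated by rewriting.  The accumulator of \<open>elem\<close> spares the simplifier
  the repeated traversal of long list literals that \<open>List.member\<close> would cause, and pattern matching on
  pairs instead of projections keeps it from unfolding definitions under binders.
\<close>

fun elem :: "bool \<Rightarrow> 'a \<Rightarrow> 'a list \<Rightarrow> bool" where
  "elem True y xs = True"
| "elem False y [] = False"
| "elem False y (x # xs) = elem (x = y) y xs"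

text \<open>With \<open>K\<close> a complete list of admissible codes, looking up the resulting code
  replaces a test that the changed column is again a (pre-)Young column.\<close>

fun within :: "'c list \<Rightarrow> ('p \<times> 'c \<times> int) list \<Rightarrow> ('p \<times> 'c \<times> int) list" where
  "within K [] = []"
| "within K ((p, c, d) # xs) = (if elem False c K then (p, c, d) # within K xs else within K xs)"

section \<open>Executable counterparts of the notions for columns\<close>

locale layers =
  fixes letters :: "'l list" and sup0 sup1 :: "'l \<Rightarrow> 'l list"
    and clr :: "'l \<Rightarrow> nat" and lev :: "'l \<Rightarrow> int"
begin

text \<open>Filtering \<open>letters\<close> keeps its order, so equal sets of letters give equal
  lists.\<close>

definition ins :: "'l \<Rightarrow> 'l list \<Rightarrow> 'l list" where
  "ins l A = filter (\<lambda>x. x = l \<or> x \<in> set A) letters"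

definition del :: "'l \<Rightarrow> 'l list \<Rightarrow> 'l list" where
  "del l A = filter (\<lambda>x. x \<noteq> l) A"

text \<open>
  A candidate \<open>(p, c', d)\<close> stands for adding (or deleting) the block \<open>place n p\<close>, which turns
  \<open>col n c\<close> into \<open>col (n + d) c'\<close>.  Higher blocks come first in \<open>add_cands\<close> and last in \<open>del_cands\<close>,
  so that in both lists the crystal operators select the first candidate.
\<close>

fun add_cands :: "nat \<Rightarrow> 'l code \<Rightarrow> ('l block \<times> 'l code \<times> int) list" where
  "add_cands i (A, B) =
     map (\<lambda>l. ((l, 1), (A, ins l B), 0)) (filter (\<lambda>l. clr l = i \<and> l \<notin> set B) letters) @
     map (\<lambda>l. ((l, 0), if ins l A = letters then ((B, []), 1) else ((ins l A, B), 0)))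
       (filter (\<lambda>l. clr l = i \<and> l \<notin> set A) letters)"

fun del_cands :: "nat \<Rightarrow> 'l code \<Rightarrow> ('l block \<times> 'l code \<times> int) list" where
  "del_cands i (A, B) =
     (if B = [] then map (\<lambda>l. ((l, - 1), (del l letters, A), - 1)) (filter (\<lambda>l. clr l = i) (rev letters))
      else []) @
     map (\<lambda>l. ((l, 0), (del l A, B), 0)) (filter (\<lambda>l. clr l = i) (rev A)) @
     map (\<lambda>l. ((l, 1), (A, del l B), 0)) (filter (\<lambda>l. clr l = i) (rev B))"

definition rel_row :: "'l block \<Rightarrow> int" where
  "rel_row p = 4 * snd p + lev (fst p)"

fun extend_ideals :: "'l \<Rightarrow> 'l list list \<Rightarrow> 'l list list" where
  "extend_ideals l [] = []"
| "extend_ideals l (I # Is) =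
     (if set (sup0 l) \<subseteq> set I then I # (l # I) # extend_ideals l Is else I # extend_ideals l Is)"

text \<open>Order ideals of the support relation inside one layer. As \<open>letters\<close> runs
  from top to bottom, the recursion has decided about the supports of \<open>l\<close> before it
  considers \<open>l\<close>.\<close>

fun ideals :: "'l list \<Rightarrow> 'l list list" where
  "ideals [] = [[]]"
| "ideals (l # ls) = extend_ideals l (ideals ls)"

fun topological :: "'l list \<Rightarrow> bool" where
  "topological [] = True"
| "topological (l # ls) = (set (sup0 l) \<subseteq> set ls \<and> topological ls)"

fun codes_over :: "'l list list \<Rightarrow> 'l code list" where
  "codes_over [] = []"
| "codes_over (A # As) =
     map (Pair A) (ideals (filter (\<lambda>l. set (sup1 l) \<subseteq> set A) letters)) @ codes_over As"

definition all_codes :: "'l code list" where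
  "all_codes = codes_over (filter (\<lambda>A. A \<noteq> letters) (ideals letters))"

text \<open>If \<open>letters\<close> is topologically sorted, supports come later in the list, and
  a single pass reaches the whole closure under \<open>sup0\<close>.\<close>

definition close :: "'l list \<Rightarrow> 'l list" where
  "close A = fold (\<lambda>l X. if l \<in> set X then sup0 l @ X else X) letters A"

definition layer_below :: "'l list \<Rightarrow> 'l list" where
  "layer_below A = concat (map sup1 (close A))"

text \<open>The cases for empty lists refer to the rows of index \<open>n\<close> and \<open>n - 1\<close>.\<close>

fun top_row :: "'l code \<Rightarrow> int" where
  "top_row (A, B) =
     (if B \<noteq> [] then 4 + Max (set (map lev B)) else if A \<noteq> [] then Max (set (map lev A))
      else Max (set (map lev letters)) - 4)"

fun exc :: "'l code list \<Rightarrow> 'l code \<Rightarrow> bool" where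
  "exc K (A, B) \<longleftrightarrow> within K (del_cands 1 (A, B)) \<noteq> [] \<and>
     length (remdups (filter (\<lambda>p. rel_row p = top_row (A, B)) (map fst (within K (del_cands 2 (A, B)))))) = 1"

text \<open>Supports of letters of \<open>A\<close> at the next lower index lie in a full layer,
  which is why \<open>sup1\<close> is tested for \<open>B\<close> only.\<close>

fun down_closed :: "'l code \<Rightarrow> bool" where
  "down_closed (A, B) \<longleftrightarrow> (\<forall>l\<in>set A. set (sup0 l) \<subseteq> set A) \<and>
     (\<forall>l\<in>set B. set (sup0 l) \<subseteq> set B \<and> set (sup1 l) \<subseteq> set A)"

fun canonical :: "'l code \<Rightarrow> bool" where
  "canonical (A, B) \<longleftrightarrow> A \<noteq> letters \<and>
     filter (\<lambda>l. l \<in> set A) letters = A \<and> filter (\<lambda>l. l \<in> set B) letters = B"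

text \<open>The finite test behind the two-layer encoding: a single block forces every block two
  indices lower.\<close>

definition deep :: "'l \<Rightarrow> bool" where
  "deep l \<longleftrightarrow> set letters \<subseteq> set (close (layer_below (layer_below [l])))"

text \<open>\<open>B \<noteq> letters\<close> guarantees that completing the lower layer raises the
  base by exactly one.\<close>

fun valid :: "'l code \<Rightarrow> bool" where
  "valid (A, B) \<longleftrightarrow> canonical (A, B) \<and> down_closed (A, B) \<and> B \<noteq> letters"

fun known :: "'l code list \<Rightarrow> 'l code \<Rightarrow> bool" where
  "known K (A, B) = elem False (A, B) K"

text \<open>That every letter supports another one excludes free blocks deep inside a column; the
  comparison with \<open>all_codes\<close> makes the two lists exhaustive.\<close>

definition consistent :: "'l code list \<Rightarrow> 'l code list \<Rightarrow> bool" where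
  "consistent excs codes \<longleftrightarrow>
     topological letters \<and>
     (\<forall>l\<in>set letters. 0 \<le> lev l \<and> lev l \<le> 3) \<and>
     (\<forall>l\<in>set letters. \<exists>l'\<in>set letters - {l}. l \<in> set (sup0 l') \<or> l \<in> set (sup1 l')) \<and>
     list_all deep letters \<and>
     list_all valid (excs @ codes) \<and>
     list_all (known (excs @ codes)) all_codes \<and>
     list_all (exc (excs @ codes)) excs \<and>
     \<not> list_ex (exc (excs @ codes)) codes"

definition step :: "(nat \<times> 'l code) list \<Rightarrow> 'l code list
    \<Rightarrow> (nat \<Rightarrow> 'l code \<Rightarrow> ('l block \<times> 'l code \<times> int) list) \<Rightarrow> nat \<Rightarrow> 'l code \<Rightarrow> ('l code \<times> int) option" where
  "step rs K cands i c =
     (if list_ex (\<lambda>(j, c'). j \<noteq> i \<and> c' = c) rs then None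
      else case within K (cands i c) of [] \<Rightarrow> None | (p, s) # _ \<Rightarrow> Some s)"

definition add_step where "add_step rs K = step rs K add_cands"

definition del_step where "del_step rs K = step rs K del_cands"

text \<open>Only the two coded layers are counted: each full layer below holds one block
  \<open>z\<close> and is accounted for by the base.\<close>

definition weight :: "'l \<Rightarrow> 'l code \<Rightarrow> int" where
  "weight z c = (if z \<in> set (fst c) then 1 else 0) + (if z \<in> set (snd c) then 1 else 0)"

text \<open>Strict sorting makes the head of a candidate list the unique extremal block. In the last
  condition, a completed layer takes one \<open>z\<close> out of the coded layers, and
  \<open>d\<close> compensates for this.\<close>

definition consistent_at :: "(nat \<times> 'l code) list \<Rightarrow> 'l \<Rightarrow> 'l code list \<Rightarrow> 'l code \<Rightarrow> nat \<Rightarrow> bool" where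
  "consistent_at rs z K c i \<longleftrightarrow>
     sorted_wrt (>) (map (rel_row \<circ> fst) (within K (add_cands i c))) \<and>
     sorted_wrt (<) (map (rel_row \<circ> fst) (within K (del_cands i c))) \<and>
     len (add_step rs K i) 4 c < 4 \<and> len (del_step rs K i) 4 c < 4 \<and>
     (case add_step rs K i c of None \<Rightarrow> True
      | Some (c', d) \<Rightarrow> weight z c' + d = weight z c + (if i = 0 then 1 else 0))"

definition consistent_code :: "(nat \<times> 'l code) list \<Rightarrow> 'l \<Rightarrow> 'l code list \<Rightarrow> 'l code \<Rightarrow> bool" where
  "consistent_code rs z K c = list_all (consistent_at rs z K c) [0, 1, 2, 3, 4]"

definition crystal_consistent :: "(nat \<times> 'l code) list \<Rightarrow> 'l \<Rightarrow> 'l code list \<Rightarrow> bool" where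
  "crystal_consistent rs z K = list_all (consistent_code rs z K) K"

end

text \<open>Lets \<open>code_simp\<close> evaluate the checks on the foundational constants before
  \<open>layered_pattern\<close>, which assumes their outcome, is interpreted.\<close>

declare layers.ins_def [code] layers.del_def [code] layers.add_cands.simps [code]
  layers.del_cands.simps [code] layers.rel_row_def [code] layers.extend_ideals.simps [code]
  layers.ideals.simps [code] layers.topological.simps [code] layers.codes_over.simps [code]
  layers.all_codes_def [code] layers.close_def [code] layers.layer_below_def [code]
  layers.top_row.simps [code] layers.exc.simps [code] layers.down_closed.simps [code]
  layers.canonical.simps [code] layers.deep_def [code] layers.valid.simps [code]
  layers.known.simps [code] layers.consistent_def [code] layers.step_def [code]
  layers.add_step_def [code] layers.del_step_def [code] layers.weight_def [code]
  layers.consistent_at_def [code] layers.consistent_code_def [code]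
  layers.crystal_consistent_def [code]

text \<open>
  An entry \<open>(p, q, f)\<close> of the lists consists of the values of \<open>\<phi>\<^sub>i\<close>, \<open>\<epsilon>\<^sub>i\<close> and the operator \<open>f\<^sub>i\<close> at a column,
  for \<open>i\<close> running through 1, 2, 3, 4, 0 in this order.  Always applying the first operator that does
  not vanish leads from every pair of columns to a pair of columns in \<open>y\<^sub>\<emptyset>\<close>; the accumulators
  \<open>n\<close> and \<open>m\<close> record the vertical shifts of both factors.
\<close>

fun pick :: "'s \<Rightarrow> 's \<Rightarrow> nat \<Rightarrow> nat \<Rightarrow> (nat \<times> nat \<times> ('s \<times> nat) option) list
    \<Rightarrow> (nat \<times> nat \<times> ('s \<times> nat) option) list \<Rightarrow> ('s \<times> 's \<times> nat \<times> nat) option" where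
  "pick a b n m ((p, _, fa) # as) ((_, q, fb) # bs) =
     (if q < p then (case fa of None \<Rightarrow> None | Some (a', d) \<Rightarrow> Some (a', b, d + n, m))
      else case fb of None \<Rightarrow> pick a b n m as bs | Some (b', d) \<Rightarrow> Some (a, b', n, d + m))"
| "pick a b n m _ _ = None"

fun walk :: "('s \<Rightarrow> (nat \<times> nat \<times> ('s \<times> nat) option) list) \<Rightarrow> 's \<Rightarrow> nat \<Rightarrow> 's \<Rightarrow> 's \<Rightarrow> nat \<Rightarrow> nat
    \<Rightarrow> (nat \<times> nat) option" where
  "walk info s0 0 a b n m = None"
| "walk info s0 (Suc k) a b n m =
     (if a = s0 \<and> b = s0 then Some (n, m)
      else case pick a b n m (info a) (info b) of None \<Rightarrow> None
        | Some (a', b', n', m') \<Rightarrow> walk info s0 k a' b' n' m')"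

text \<open>The base of the second column exceeds that of the first by \<open>n - m\<close>. At
  difference 1 the letters of \<open>A\<close> fall into the full part and \<open>B\<close> faces
  \<open>A'\<close>; from 2 on containment is automatic; a negative difference is rejected.\<close>

fun contained :: "'l code \<Rightarrow> 'l code \<Rightarrow> nat \<Rightarrow> nat \<Rightarrow> bool" where
  "contained (A, B) (A', B') n m =
     (if n = m then set A \<subseteq> set A' \<and> set B \<subseteq> set B'
      else if n = Suc m then set B \<subseteq> set A' else m < n)"

lemma elem_iff: "elem b y xs \<longleftrightarrow> b \<or> y \<in> set xs"
  by (induction b y xs rule: elem.induct) auto

lemma within_eq: "within K xs = filter (\<lambda>(p, c, d). c \<in> set K) xs"
  by (induction K xs rule: within.induct) (auto simp: elem_iff)

lemma within_iff: "x \<in> set (within K xs) \<longleftrightarrow> x \<in> set xs \<and> fst (snd x) \<in> set K"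
  by (auto simp: within_eq)

lemma Ex1_mem_iff_card: "(\<exists>!x. x \<in> T) \<longleftrightarrow> card T = 1"
proof
  assume "\<exists>!x. x \<in> T"
  then obtain x where "T = {x}" by auto
  then show "card T = 1" by simp
next
  assume "card T = 1"
  then show "\<exists>!x. x \<in> T" by (auto simp: card_1_singleton_iff)
qed

section \<open>Pre-Young columns and their codes\<close>

locale layered_pattern = layers letters sup0 sup1 clr lev
  for letters :: "'l list" and sup0 sup1 clr lev +
  fixes P :: "'l pattern" and excs codes :: "'l code list"
  assumes below: "below P l = (\<lambda>l'. (l', 0)) ` set (sup0 l) \<union> (\<lambda>l'. (l', - 1)) ` set (sup1 l)"
    and color: "color P = clr" and level: "level P = lev" and letters: "set letters = UNIV"
    and consistent: "consistent excs codes"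
begin

lemma mem_letters [simp]: "l \<in> set letters"
  by (simp add: letters)

lemma rests_on_iff:
  "rests_on P (l, m) (l', m') \<longleftrightarrow> m' = m \<and> l' \<in> set (sup0 l) \<or> m' = m - 1 \<and> l' \<in> set (sup1 l)"
  by (auto simp: rests_on_def below image_iff)

lemma lev_bounds: "0 \<le> lev l" "lev l \<le> 3"
  using consistent letters by (auto simp: consistent_def deep_def list_all_iff)

lemma row_eq: "row P x = 4 * snd x + lev (fst x)"
  by (simp add: row_def level)

text \<open>Levels lie between 0 and 3, so a bound on rows amounts to a bound on indices.\<close>

lemma pre_young_iff:
  "pre_young P y \<longleftrightarrow> y \<noteq> {} \<and> (\<exists>r. \<forall>x\<in>y. snd x \<le> r) \<and>
     (\<forall>l m. (l, m) \<in> y \<longrightarrow> (\<forall>l'\<in>set (sup0 l). (l', m) \<in> y) \<and> (\<forall>l'\<in>set (sup1 l). (l', m - 1) \<in> y))"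
proof -
  have "(\<exists>r. \<forall>x\<in>y. row P x \<le> r) \<longleftrightarrow> (\<exists>r. \<forall>x\<in>y. snd x \<le> r)" (is "?L \<longleftrightarrow> ?R")
  proof
    assume ?L
    then obtain r where r: "row P x \<le> r" if "x \<in> y" for x by blast
    have "snd x \<le> \<bar>r\<bar>" if "x \<in> y" for x
      using r[OF that] lev_bounds[of "fst x"] by (simp add: row_eq)
    then show ?R by blast
  next
    assume ?R
    then obtain r where r: "snd x \<le> r" if "x \<in> y" for x by blast
    have "row P x \<le> 4 * r + 3" if "x \<in> y" for x
      using r[OF that] lev_bounds[of "fst x"] by (simp add: row_eq)
    then show ?L by blast
  qed
  moreover have "(\<forall>x\<in>y. \<forall>x'. rests_on P x x' \<longrightarrow> x' \<in> y) \<longleftrightarrow>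
      (\<forall>l m. (l, m) \<in> y \<longrightarrow> (\<forall>l'\<in>set (sup0 l). (l', m) \<in> y) \<and> (\<forall>l'\<in>set (sup1 l). (l', m - 1) \<in> y))"
    by (auto simp: rests_on_iff)
  ultimately show ?thesis unfolding pre_young_def by blast
qed

lemma pre_young_col: "pre_young P (col n c) \<longleftrightarrow> down_closed c"
proof (cases c)
  case (Pair A B)
  have "(undefined, n - 1) \<in> col n c" using Pair by simp
  then have ne: "col n c \<noteq> {}" by blast
  have bd: "\<exists>r. \<forall>x\<in>col n c. snd x \<le> r" using Pair by (intro exI[of _ "n + 1"]) auto
  show ?thesis
  proof
    assume "pre_young P (col n c)"
    then have a: "\<forall>l m. (l, m) \<in> col n c \<longrightarrow> (\<forall>l'\<in>set (sup0 l). (l', m) \<in> col n c) \<and>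
        (\<forall>l'\<in>set (sup1 l). (l', m - 1) \<in> col n c)"
      by (simp add: pre_young_iff)
    show "down_closed c"
      using a[rule_format, of _ n] a[rule_format, of _ "n + 1"] Pair by auto
  next
    assume "down_closed c"
    then show "pre_young P (col n c)"
      unfolding pre_young_iff using ne bd Pair by auto
  qed
qed

lemma sup0_mem: "pre_young P y \<Longrightarrow> (l, m) \<in> y \<Longrightarrow> l' \<in> set (sup0 l) \<Longrightarrow> (l', m) \<in> y"
  by (simp add: pre_young_iff)

lemma sup1_mem: "pre_young P y \<Longrightarrow> (l, m) \<in> y \<Longrightarrow> l' \<in> set (sup1 l) \<Longrightarrow> (l', m - 1) \<in> y"
  by (simp add: pre_young_iff)

lemma close_mem:
  assumes "pre_young P y" "\<forall>l\<in>set A. (l, m) \<in> y"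
  shows "\<forall>l\<in>set (close A). (l, m) \<in> y"
proof -
  have "\<forall>l\<in>set (fold (\<lambda>l X. if l \<in> set X then sup0 l @ X else X) ls A). (l, m) \<in> y" for ls
    using assms(2)
  proof (induction ls arbitrary: A)
    case (Cons a ls)
    have "\<forall>l\<in>set (if a \<in> set A then sup0 a @ A else A). (l, m) \<in> y"
      using Cons.prems sup0_mem[OF assms(1)] by auto
    from Cons.IH[OF this] show ?case by simp
  qed simp
  then show ?thesis by (simp add: close_def)
qed

lemma layer_below_mem:
  assumes "pre_young P y" "\<forall>l\<in>set A. (l, m) \<in> y"
  shows "\<forall>l\<in>set (layer_below A). (l, m - 1) \<in> y"
  using close_mem[OF assms] by (auto simp: layer_below_def dest: sup1_mem[OF assms(1)])

lemma close_Nil: "close [] = []"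
proof -
  have "fold (\<lambda>l X. if l \<in> set X then sup0 l @ X else X) ls [] = []" for ls
    by (induction ls) auto
  then show ?thesis by (simp add: close_def)
qed

lemma full_below:
  assumes "pre_young P y" "(l, m) \<in> y" "m' \<le> m - 2"
  shows "(l', m') \<in> y"
proof -
  have sub: "set letters \<subseteq> set (close (layer_below (layer_below [l])))" for l
    using consistent letters by (auto simp: consistent_def deep_def list_all_iff)
  have two: "(l', m - 2) \<in> y" if "(l, m) \<in> y" for l m l'
  proof -
    have "\<forall>l'\<in>set [l]. (l', m) \<in> y" using that by simp
    from close_mem[OF assms(1) layer_below_mem[OF assms(1) layer_below_mem[OF assms(1) this]]]
    show ?thesis using sub[of l] by auto
  qed
  \<comment> \<open>If nothing lay below, the closure two layers down would be empty instead of
    everything.\<close>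
  have one: "\<exists>l'. (l', m - 1) \<in> y" if "(l, m) \<in> y" for l m
  proof -
    have "layer_below [l] \<noteq> []"
    proof
      assume "layer_below [l] = []"
      then have "close (layer_below (layer_below [l])) = []"
        by (simp add: close_Nil layer_below_def[of "[]"])
      then show False using sub[of l] letters by simp
    qed
    then show ?thesis using layer_below_mem[OF assms(1), of "[l]" m] that
      by (metis list.set_sel(1) set_ConsD empty_iff empty_set)
  qed
  have "\<exists>l'. (l', m - int k) \<in> y" for k
  proof (induction k)
    case 0
    then show ?case using assms(2) by auto
  next
    case (Suc k)
    then obtain l' where "(l', m - int k) \<in> y" by blast
    from one[OF this] show ?case by (simp add: algebra_simps)
  qed
  \<comment> \<open>Descending layer by layer reaches some block of index \<open>m' + 2\<close>, and
    that block forces all of index \<open>m'\<close>.\<close>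
  from this[of "nat (m - 2 - m')"] obtain l'' where "(l'', m' + 2) \<in> y"
    using assms(3) by (auto simp: add.commute)
  from two[OF this] show ?thesis by simp
qed

lemma set_extend_ideals:
  "set (extend_ideals l Is) = set Is \<union> (Cons l) ` {I \<in> set Is. set (sup0 l) \<subseteq> set I}"
  by (induction l Is rule: extend_ideals.induct) auto

lemma ideals_complete:
  assumes "topological ls" "\<And>l l'. l \<in> S \<Longrightarrow> l' \<in> set (sup0 l) \<Longrightarrow> l' \<in> S" "\<And>l. l \<in> S \<Longrightarrow> ok l"
  shows "filter (\<lambda>l. l \<in> S) ls \<in> set (ideals (filter ok ls))"
  using assms(1)
proof (induction ls)
  case (Cons a ls)
  then have IH: "filter (\<lambda>l. l \<in> S) ls \<in> set (ideals (filter ok ls))" by simp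
  show ?case
  proof (cases "a \<in> S")
    case True
    then have "set (sup0 a) \<subseteq> set (filter (\<lambda>l. l \<in> S) ls)" using Cons.prems assms(2) by auto
    then have "a # filter (\<lambda>l. l \<in> S) ls \<in> set (extend_ideals a (ideals (filter ok ls)))"
      unfolding set_extend_ideals using IH by blast
    then show ?thesis using True assms(3) by simp
  qed (use IH in \<open>simp add: set_extend_ideals\<close>)
qed simp

lemma set_codes_over:
  "set (codes_over As) =
     {(A, B). A \<in> set As \<and> B \<in> set (ideals (filter (\<lambda>l. set (sup1 l) \<subseteq> set A) letters))}"
  by (induction As) auto

lemma known_iff: "known K c \<longleftrightarrow> c \<in> set K"
  by (cases c) (simp add: elem_iff)

text \<open>Let \<open>M\<close> be the highest occupied index. The base is \<open>M - 1\<close>,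
  unless this layer is full; then it is \<open>M\<close>, or \<open>M + 1\<close> if layer
  \<open>M\<close> is full as well.\<close>

lemma pre_code:
  assumes "pre_young P y"
  obtains n c where "c \<in> set (excs @ codes)" "y = col n c"
proof -
  note result = that
  from assms have "y \<noteq> {}" "\<exists>r. \<forall>x\<in>y. snd x \<le> r" by (simp_all add: pre_young_iff)
  then obtain x0 r where x0: "x0 \<in> y" and r: "\<And>x. x \<in> y \<Longrightarrow> snd x \<le> r"
    by blast
  \<comment> \<open>A column is unbounded below; the interval provides the finiteness required by
    \<open>Max\<close>.\<close>
  define M where "M = Max (snd ` y \<inter> {snd x0..r})"
  have fin: "finite (snd ` y \<inter> {snd x0..r})" by simp
  have "snd x0 \<in> snd ` y \<inter> {snd x0..r}" using x0 r by auto
  then have "M \<in> snd ` y \<inter> {snd x0..r}" unfolding M_def using Max_in[OF fin] by blast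
  then obtain l0 where l0: "(l0, M) \<in> y" by auto
  have M: "snd x \<le> M" if "x \<in> y" for x
  proof (cases "snd x0 \<le> snd x")
    case True
    then show ?thesis unfolding M_def using that r by (intro Max_ge fin) auto
  next
    case False
    moreover have "snd x0 \<le> M" unfolding M_def using x0 r by (intro Max_ge fin) auto
    ultimately show ?thesis by simp
  qed
  define L where "L m = filter (\<lambda>l. (l, m) \<in> y) letters" for m
  have L: "l \<in> set (L m) \<longleftrightarrow> (l, m) \<in> y" for l m using letters by (auto simp: L_def)
  have col: "y = col (m - 1) (L (m - 1), L m)" if "M \<le> m" "\<And>l m'. m' < m - 1 \<Longrightarrow> (l, m') \<in> y" for m
  proof (intro set_eqI)
    fix x :: "'l block"
    show "x \<in> y \<longleftrightarrow> x \<in> col (m - 1) (L (m - 1), L m)"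
    proof (cases x)
      case (Pair l k)
      then show ?thesis using M[of x] that by (auto simp: L) (smt (verit))+
    qed
  qed
  have mem: "(L (m - 1), L m) \<in> set all_codes" if "L (m - 1) \<noteq> letters" for m
  proof -
    have top: "topological letters" using consistent by (simp add: consistent_def)
    have "L (m - 1) \<in> set (ideals letters)"
      using ideals_complete[OF top, of "{l. (l, m - 1) \<in> y}" "\<lambda>_. True"] sup0_mem[OF assms]
      by (auto simp: L_def)
    moreover have "L m \<in> set (ideals (filter (\<lambda>l. set (sup1 l) \<subseteq> set (L (m - 1))) letters))"
      using ideals_complete[OF top, of "{l. (l, m) \<in> y}" "\<lambda>l. set (sup1 l) \<subseteq> set (L (m - 1))"]
        sup0_mem[OF assms] sup1_mem[OF assms] L[of _ "m - 1"]
      by (simp add: L_def subset_iff)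
    ultimately show ?thesis using that by (auto simp: all_codes_def set_codes_over)
  qed
  have code: thesis if "M \<le> m" "\<And>l m'. m' < m - 1 \<Longrightarrow> (l, m') \<in> y" "L (m - 1) \<noteq> letters" for m
  proof -
    have "(L (m - 1), L m) \<in> set (excs @ codes)"
      using consistent mem[OF that(3)] known_iff unfolding consistent_def list_all_iff by blast
    then show thesis using col[OF that(1,2)] result by blast
  qed
  have full: "(l, m') \<in> y" if "m' < M - 1" for l m' using full_below[OF assms l0] that by simp
  have all: "(l, m) \<in> y" if "L m = letters" for l m using L[of l m] that letters by simp
  have step: "(l, m') \<in> y" if "m' < M" "L (M - 1) = letters" for l m'
    using full[of m' l] all[OF that(2), of l] that(1) by (cases "m' < M - 1") (auto simp: order.strict_iff_order)
  show thesis
  proof (cases "L (M - 1) = letters")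
    case False
    then show ?thesis using code[of M] full by auto
  next
    case True
    show ?thesis
    proof (cases "L M = letters")
      case False
      then show ?thesis using code[of "M + 1"] step[OF _ True] by auto
    next
      case Tr: True
      \<comment> \<open>Here the code is empty: layer \<open>M + 1\<close> is the first incomplete
        one and contains nothing.\<close>
      have Nil: "L (M + 2 - 1) = []" using M by (fastforce simp: L_def filter_empty_conv)
      have "(l, m') \<in> y" if "m' < M + 2 - 1" for l m'
        using step[OF _ True, of m' l] all[OF Tr, of l] that by (cases "m' = M") auto
      then show ?thesis
      proof (rule code[rotated])
        show "L (M + 2 - 1) \<noteq> letters" using Nil letters by auto
        show "M \<le> M + 2" by linarith
      qed
    qed
  qed
qed

abbreviation pre_codes :: "'l code list" where
  "pre_codes \<equiv> excs @ codes"

lemma valid_iff: "valid c \<longleftrightarrow> canonical c \<and> down_closed c \<and> snd c \<noteq> letters"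
  by (cases c) simp

lemma pre_codesD:
  assumes "c \<in> set pre_codes"
  shows "canonical c" "down_closed c" "snd c \<noteq> letters"
proof -
  have "valid c" using consistent assms by (auto simp: consistent_def list_all_iff)
  then show "canonical c" "down_closed c" "snd c \<noteq> letters" by (simp_all add: valid_iff)
qed

lemma canonical_notin:
  assumes "canonical (A, B)" obtains l where "l \<notin> set A"
  using assms letters by (metis canonical.simps filter_True)

text \<open>The base is recovered as the least index at which a letter is missing, and the fixed
  order of letters recovers the lists.\<close>

lemma col_inj:
  assumes "canonical c" "canonical c'" "col n c = col n' c'"
  shows "n = n' \<and> c = c'"
proof -
  have aux: "\<not> n < n'" if can: "canonical c" and eq: "col n c = col n' c'" for n n' :: int and c c'
  proof
    assume "n < n'"
    obtain A B A' B' where c: "c = (A, B)" "c' = (A', B')" by fastforce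
    obtain l where "l \<notin> set A" using canonical_notin can unfolding c by blast
    then have "(l, n) \<notin> col n c" using c by auto
    moreover have "(l, n) \<in> col n' c'" using c \<open>n < n'\<close> by auto
    ultimately show False using eq by blast
  qed
  have n: "n = n'" using aux[OF assms(1,3)] aux[OF assms(2) assms(3)[symmetric]] by simp
  obtain A B A' B' where c: "c = (A, B)" "c' = (A', B')" by fastforce
  have mem: "(l, m) \<in> col n c \<longleftrightarrow> (l, m) \<in> col n c'" for l m using assms(3) n by simp
  have sA: "set A = set A'" using mem[of _ n] c by auto
  have sB: "set B = set B'" using mem[of _ "n + 1"] c by auto
  have "A = A'" "B = B'" using assms(1,2) sA sB c by simp_all
  then show ?thesis using n c by simp
qed

lemma pre_young_code_iff:
  assumes "canonical c"
  shows "pre_young P (col n c) \<longleftrightarrow> c \<in> set pre_codes"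
proof
  assume "pre_young P (col n c)"
  then obtain n' c' where "c' \<in> set pre_codes" "col n c = col n' c'" by (rule pre_code)
  then show "c \<in> set pre_codes" using col_inj[OF assms pre_codesD(1)] by metis
qed (simp add: pre_young_col pre_codesD(2))

section \<open>Adding and deleting blocks on codes\<close>

lemma add_cands_col:
  assumes "canonical c" "snd c \<noteq> letters" "(p, c', d) \<in> set (add_cands i c)"
  shows "place n p \<notin> col n c" "insert (place n p) (col n c) = col (n + d) c'" "canonical c'"
    "clr (fst p) = i"
proof -
  obtain A B where c: "c = (A, B)" by fastforce
  have ins: "x \<in> set (ins l A) \<longleftrightarrow> x = l \<or> x \<in> set A" for x l A
    using letters by (auto simp: ins_def)
  have fin: "filter (\<lambda>x. x = l \<or> x \<in> set A) letters = ins l A" for l A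
    by (simp add: ins_def)
  have "place n p \<notin> col n c \<and> insert (place n p) (col n c) = col (n + d) c' \<and> canonical c' \<and>
      clr (fst p) = i"
    using assms(3) unfolding c add_cands.simps set_append Un_iff
  proof
    assume "(p, c', d) \<in> set (map (\<lambda>l. ((l, 1), (A, ins l B), 0))
      (filter (\<lambda>l. clr l = i \<and> l \<notin> set B) letters))"
    then obtain l where l: "p = (l, 1)" "c' = (A, ins l B)" "d = 0" "clr l = i" "l \<notin> set B" by auto
    then show "place n p \<notin> col n (A, B) \<and> insert (place n p) (col n (A, B)) = col (n + d) c' \<and>
        canonical c' \<and> clr (fst p) = i"
      using assms(1) fin c by (auto simp: place_def ins)
  next
    assume "(p, c', d) \<in> set (map (\<lambda>l. ((l, 0), if ins l A = letters then ((B, []), 1) else ((ins l A, B), 0)))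
      (filter (\<lambda>l. clr l = i \<and> l \<notin> set A) letters))"
    then obtain l where l: "p = (l, 0)" "clr l = i" "l \<notin> set A"
      and c': "(c', d) = (if ins l A = letters then ((B, []), 1) else ((ins l A, B), 0))" by auto
    show "place n p \<notin> col n (A, B) \<and> insert (place n p) (col n (A, B)) = col (n + d) c' \<and>
        canonical c' \<and> clr (fst p) = i"
    proof (cases "ins l A = letters")
      case True
      \<comment> \<open>Only \<open>l\<close> was missing from \<open>A\<close>, so the layer
        becomes full and \<open>B\<close>, which is not full, becomes the lower coded layer.\<close>
      then have "x \<noteq> l \<Longrightarrow> x \<in> set A" for x using ins[of x l A] by simp
      then show ?thesis using True c' l assms(1,2) c by (auto simp: place_def)
    next
      case False
      then show ?thesis using c' l assms(1) fin c by (auto simp: place_def ins)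
    qed
  qed
  then show "place n p \<notin> col n c" "insert (place n p) (col n c) = col (n + d) c'" "canonical c'"
    "clr (fst p) = i" by blast+
qed

lemma del_cands_col:
  assumes "canonical c" "(p, c', d) \<in> set (del_cands i c)"
  shows "place n p \<in> col n c" "col n c - {place n p} = col (n + d) c'" "canonical c'"
    "clr (fst p) = i"
proof -
  obtain A B where c: "c = (A, B)" by fastforce
  have del: "x \<in> set (del l A) \<longleftrightarrow> x \<noteq> l \<and> x \<in> set A" for x l A
    by (auto simp: del_def)
  have fin: "filter (\<lambda>x. x \<noteq> l \<and> x \<in> set A) letters = del l A"
    if "filter (\<lambda>l. l \<in> set A) letters = A" for l A
  proof -
    have "filter (\<lambda>x. x \<noteq> l \<and> x \<in> set A) letters =
        filter (\<lambda>x. x \<noteq> l) (filter (\<lambda>x. x \<in> set A) letters)"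
      by (simp add: conj_commute)
    then show ?thesis by (simp only: that del_def)
  qed
  have ne: "del l A \<noteq> letters" for l A
    using del[of l l A] letters by auto
  have "place n p \<in> col n c \<and> col n c - {place n p} = col (n + d) c' \<and> canonical c' \<and>
      clr (fst p) = i"
    using assms(2) unfolding c del_cands.simps set_append Un_iff
  proof (elim disjE)
    assume "(p, c', d) \<in> set (if B = [] then map (\<lambda>l. ((l, - 1), (del l letters, A), - 1))
      (filter (\<lambda>l. clr l = i) (rev letters)) else [])"
    then obtain l where l: "B = []" "p = (l, - 1)" "c' = (del l letters, A)" "d = - 1" "clr l = i"
      by (auto split: if_splits)
    then show "place n p \<in> col n (A, B) \<and> col n (A, B) - {place n p} = col (n + d) c' \<and>
        canonical c' \<and> clr (fst p) = i"
      using assms(1) fin[of letters] ne c by (auto simp: place_def del)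
  next
    assume "(p, c', d) \<in> set (map (\<lambda>l. ((l, 0), (del l A, B), 0)) (filter (\<lambda>l. clr l = i) (rev A)))"
    then obtain l where l: "p = (l, 0)" "c' = (del l A, B)" "d = 0" "clr l = i" "l \<in> set A" by auto
    then show "place n p \<in> col n (A, B) \<and> col n (A, B) - {place n p} = col (n + d) c' \<and>
        canonical c' \<and> clr (fst p) = i"
      using assms(1) fin ne c by (auto simp: place_def del)
  next
    assume "(p, c', d) \<in> set (map (\<lambda>l. ((l, 1), (A, del l B), 0)) (filter (\<lambda>l. clr l = i) (rev B)))"
    then obtain l where l: "p = (l, 1)" "c' = (A, del l B)" "d = 0" "clr l = i" "l \<in> set B" by auto
    then show "place n p \<in> col n (A, B) \<and> col n (A, B) - {place n p} = col (n + d) c' \<and>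
        canonical c' \<and> clr (fst p) = i"
      using assms(1) fin ne c by (auto simp: place_def del)
  qed
  then show "place n p \<in> col n c" "col n c - {place n p} = col (n + d) c'" "canonical c'"
    "clr (fst p) = i" by blast+
qed

lemma add_cands_complete:
  assumes c: "c \<in> set pre_codes" and x: "x \<notin> col n c" and y: "pre_young P (insert x (col n c))"
  shows "\<exists>p c' d. (p, c', d) \<in> set (add_cands (clr (fst x)) c) \<and> x = place n p"
proof -
  obtain A B where AB: "c = (A, B)" by fastforce
  obtain l m where lm: "x = (l, m)" by fastforce
  obtain l' where l': "l' \<notin> set A" using canonical_notin pre_codesD(1)[OF c] unfolding AB by blast
  \<comment> \<open>A block this high would force the missing letter \<open>l'\<close> at index
    \<open>n\<close>.\<close>
  have "\<not> m \<ge> n + 2"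
  proof
    assume "m \<ge> n + 2"
    then have "(l', n) \<in> insert x (col n c)" using full_below[OF y, of l m n l'] lm by simp
    then show False using l' AB lm \<open>m \<ge> n + 2\<close> by auto
  qed
  moreover have "\<not> m < n" using x AB lm by auto
  ultimately consider "m = n" | "m = n + 1" by linarith
  then show ?thesis
  proof cases
    case 1
    then have "l \<notin> set A" using x AB lm by auto
    then show ?thesis unfolding AB add_cands.simps set_append Un_iff ex_simps
      using 1 lm letters by (intro exI[of _ "(l, 0)"] exI) (auto simp: place_def image_iff)
  next
    case 2
    then have "l \<notin> set B" using x AB lm by auto
    then show ?thesis unfolding AB
      using 2 lm letters by (intro exI[of _ "(l, 1)"] exI[of _ "(A, ins l B)"] exI[of _ 0]) (auto simp: place_def)
  qed
qed

lemma del_cands_complete: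
  assumes c: "c \<in> set pre_codes" and x: "x \<in> col n c" and y: "pre_young P (col n c - {x})"
  shows "\<exists>p c' d. (p, c', d) \<in> set (del_cands (clr (fst x)) c) \<and> x = place n p"
proof -
  obtain A B where AB: "c = (A, B)" by fastforce
  obtain l m where lm: "x = (l, m)" by fastforce
  obtain l' where l': "l' \<noteq> l" "l \<in> set (sup0 l') \<or> l \<in> set (sup1 l')"
    using consistent mem_letters[of l] unfolding consistent_def by blast
  \<comment> \<open>Such a block supports a different block of index at most \<open>n - 1\<close>,
    which belongs to the full part of the column.\<close>
  have "\<not> m < n - 1"
  proof
    assume m: "m < n - 1"
    show False
    proof (cases "l \<in> set (sup1 l')")
      case True
      then show False using sup1_mem[OF y, of l' "m + 1" l] m lm AB by auto
    next
      case False
      then show False using l' sup0_mem[OF y, of l' m l] m lm AB by auto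
    qed
  qed
  \<comment> \<open>A block of index \<open>n + 1\<close> forces the whole layer
    \<open>n - 1\<close>.\<close>
  moreover have "B = []" if "m = n - 1"
  proof (rule ccontr)
    assume "B \<noteq> []"
    then obtain b where "b \<in> set B" by (cases B) auto
    then have "(b, n + 1) \<in> col n c - {x}" using AB lm that by auto
    from full_below[OF y this, of m l] show False using that lm by simp
  qed
  moreover have "m \<le> n + 1" using x AB lm by auto
  ultimately consider "m = n - 1" "B = []" | "m = n" | "m = n + 1" by linarith
  then show ?thesis
  proof cases
    case 1
    then show ?thesis unfolding AB
      using lm letters by (intro exI[of _ "(l, - 1)"] exI[of _ "(del l letters, A)"] exI[of _ "- 1"]) (auto simp: place_def)
  next
    case 2
    then show ?thesis unfolding AB
      using lm x AB by (intro exI[of _ "(l, 0)"] exI[of _ "(del l A, B)"] exI[of _ 0]) (auto simp: place_def)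
  next
    case 3
    then show ?thesis unfolding AB
      using lm x AB by (intro exI[of _ "(l, 1)"] exI[of _ "(A, del l B)"] exI[of _ 0]) (auto simp: place_def)
  qed
qed

lemma place_inj [simp]: "place n p = place n p' \<longleftrightarrow> p = p'"
  by (auto simp: place_def prod_eq_iff)

lemma row_place: "row P (place n p) = 4 * n + rel_row p"
  by (simp add: row_eq place_def rel_row_def)

lemma block_color_place: "block_color P (place n p) = clr (fst p)"
  by (simp add: block_color_def place_def color)

section \<open>Free blocks and exceptional columns\<close>

lemma free_block_col:
  assumes c: "c \<in> set pre_codes"
  shows "free_block P (col n c) x \<and> block_color P x = i \<longleftrightarrow>
    x \<in> place n ` fst ` set (within pre_codes (del_cands i c))"
proof
  assume "free_block P (col n c) x \<and> block_color P x = i"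
  then have x: "x \<in> col n c" "pre_young P (col n c - {x})" "clr (fst x) = i"
    by (simp_all add: free_block_def block_color_def color)
  from del_cands_complete[OF c x(1,2)] x(3) obtain p c' d
    where p: "(p, c', d) \<in> set (del_cands i c)" "x = place n p" by blast
  note del = del_cands_col(1,2)[OF pre_codesD(1)[OF c] p(1), of n] del_cands_col(3,4)[OF pre_codesD(1)[OF c] p(1)]
  then have "c' \<in> set pre_codes" using x(2) p(2) pre_young_code_iff[OF del(3)] by simp
  then show "x \<in> place n ` fst ` set (within pre_codes (del_cands i c))"
    using p by (force simp: within_iff)
next
  assume "x \<in> place n ` fst ` set (within pre_codes (del_cands i c))"
  then obtain p c' d where p: "(p, c', d) \<in> set (del_cands i c)" "c' \<in> set pre_codes" "x = place n p"
    by (auto simp: within_iff)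
  note del = del_cands_col(1,2)[OF pre_codesD(1)[OF c] p(1), of n] del_cands_col(3,4)[OF pre_codesD(1)[OF c] p(1)]
  then show "free_block P (col n c) x \<and> block_color P x = i"
    using p pre_young_code_iff[OF del(3)] by (simp add: free_block_def block_color_place)
qed

lemma top_row:
  assumes "x \<in> col n c" shows "row P x \<le> 4 * n + top_row c"
proof -
  obtain A B where c: "c = (A, B)" by fastforce
  obtain l m where x: "x = (l, m)" by fastforce
  have Max_le: "lev l \<le> Max (set (map lev ls))" if "l \<in> set ls" for l ls using that by simp
  have Max0: "0 \<le> Max (set (map lev ls))" if ne: "ls \<noteq> []" for ls
  proof -
    obtain l where "l \<in> set ls" using ne by (cases ls) auto
    then show ?thesis using Max_le[of l ls] lev_bounds(1)[of l] by linarith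
  qed
  define f where "f ls = Max (set (map lev ls))" for ls
  have f: "lev l \<le> f ls" if "l \<in> set ls" for ls using Max_le[OF that] by (simp only: f_def)
  have f0: "0 \<le> f ls" if "ls \<noteq> []" for ls using Max0[OF that] by (simp only: f_def)
  have "top_row c = (if B \<noteq> [] then 4 + f B else if A \<noteq> [] then f A else f letters - 4)"
    by (simp add: c f_def)
  then show ?thesis
    using assms c x lev_bounds[of l] f[of A] f[of B] f[of letters] f0[of A] f0[of B]
    by (auto simp: row_eq split: if_splits)
qed

lemma top_row_attained: "\<exists>x\<in>col n c. row P x = 4 * n + top_row c"
proof -
  obtain A B where c: "c = (A, B)" by fastforce
  have attained: "\<exists>l\<in>set ls. lev l = Max (set (map lev ls))" if "ls \<noteq> []" for ls
  proof -
    have "Max (set (map lev ls)) \<in> set (map lev ls)" using that by (intro Max_in) auto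
    then show ?thesis by (metis imageE set_map)
  qed
  have "letters \<noteq> []" using letters by auto
  consider "B \<noteq> []" | "B = []" "A \<noteq> []" | "B = []" "A = []" by blast
  then show ?thesis
  proof cases
    case 1
    then obtain l where "l \<in> set B" "lev l = Max (set (map lev B))" using attained by blast
    then show ?thesis using 1 c by (intro bexI[of _ "(l, n + 1)"]) (auto simp: row_eq)
  next
    case 2
    then obtain l where "l \<in> set A" "lev l = Max (set (map lev A))" using attained by blast
    then show ?thesis using 2 c by (intro bexI[of _ "(l, n)"]) (auto simp: row_eq)
  next
    case 3
    obtain l where "lev l = Max (set (map lev letters))" using attained[OF \<open>letters \<noteq> []\<close>] by blast
    then show ?thesis using 3 c by (intro bexI[of _ "(l, n - 1)"]) (auto simp: row_eq)
  qed
qed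

text \<open>The quantified \<open>r\<close> can only be the top row, and injectivity of
  \<open>place\<close> turns unique existence into a count over the candidate list.\<close>

lemma exceptional_col:
  assumes c: "c \<in> set pre_codes"
  shows "exceptional P (col n c) \<longleftrightarrow> exc pre_codes c"
proof -
  define F where "F i = map fst (within pre_codes (del_cands i c))" for i
  have F: "free_block P (col n c) x \<and> block_color P x = i \<longleftrightarrow> x \<in> place n ` set (F i)" for i x
    using free_block_col[OF c] by (simp add: F_def)
  have top: "(\<exists>x\<in>col n c. row P x = r) \<and> (\<forall>x\<in>col n c. row P x \<le> r) \<longleftrightarrow> r = 4 * n + top_row c" for r
  proof
    assume r: "(\<exists>x\<in>col n c. row P x = r) \<and> (\<forall>x\<in>col n c. row P x \<le> r)"
    then have "r \<le> 4 * n + top_row c" using top_row by blast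
    moreover have "4 * n + top_row c \<le> r" using r top_row_attained[of n c] by fastforce
    ultimately show "r = 4 * n + top_row c" by simp
  qed (use top_row top_row_attained in blast)
  have pre: "pre_young P (col n c)" using pre_young_code_iff[OF pre_codesD(1)[OF c]] c by blast
  define S where "S = {p \<in> set (F 2). rel_row p = top_row c}"
  have S: "free_block P (col n c) x \<and> block_color P x = 2 \<and> row P x = 4 * n + top_row c \<longleftrightarrow>
      x \<in> place n ` S" for x
    using F[of x 2] by (auto simp: S_def row_place)
  have "(\<exists>r. (\<exists>x\<in>col n c. row P x = r) \<and> (\<forall>x\<in>col n c. row P x \<le> r) \<and> Q r) \<longleftrightarrow>
      Q (4 * n + top_row c)" for Q
    unfolding conj_assoc[symmetric] top by simp
  then have "exceptional P (col n c) \<longleftrightarrow> (\<exists>!x. x \<in> place n ` S) \<and> (\<exists>x. x \<in> place n ` set (F 1))"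
    unfolding exceptional_def using pre by (simp only: S F simp_thms)
  also have "(\<exists>!x. x \<in> place n ` S) \<longleftrightarrow> card (place n ` S) = 1"
    by (rule Ex1_mem_iff_card)
  also have "card (place n ` S) = card S"
    by (rule card_image) (simp add: inj_on_def)
  also have "card S = length (remdups (filter (\<lambda>p. rel_row p = top_row c) (F 2)))"
    by (simp add: length_remdups_card_conv S_def)
  finally show ?thesis by (cases c) (auto simp: F_def)
qed

text \<open>By the check, \<open>exc\<close> holds on all of \<open>excs\<close> and nowhere on
  \<open>codes\<close>, so it separates the two lists.\<close>

lemma young_col_iff:
  assumes "canonical c"
  shows "young P (col n c) \<longleftrightarrow> c \<in> set codes"
proof -
  have "exc pre_codes c \<longleftrightarrow> c \<in> set excs" "c \<in> set excs \<Longrightarrow> c \<notin> set codes" if "c \<in> set pre_codes"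
    using that consistent by (auto simp: consistent_def list_all_iff list_ex_iff)
  then show ?thesis
    unfolding young_def using pre_young_code_iff[OF assms, of n] exceptional_col[of c n] by auto
qed

lemma young_code:
  assumes "young P y"
  obtains n c where "c \<in> set codes" "y = col n c"
proof -
  obtain n c where c: "c \<in> set pre_codes" "y = col n c"
    using assms pre_code unfolding young_def by blast
  then show thesis using that assms young_col_iff[OF pre_codesD(1)] by blast
qed

lemma codesD:
  assumes "c \<in> set codes"
  shows "c \<in> set pre_codes" "canonical c" "snd c \<noteq> letters" "young P (col n c)"
proof -
  show pre: "c \<in> set pre_codes" using assms by simp
  show "canonical c" "snd c \<noteq> letters" using pre_codesD[OF pre] by simp_all
  then show "young P (col n c)" using assms young_col_iff by simp
qed

section \<open>Addable and removable blocks, classes of columns\<close>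

lemma addable_col:
  assumes c: "c \<in> set codes"
  shows "addable P i (col n c) x \<longleftrightarrow> x \<in> place n ` fst ` set (within codes (add_cands i c))"
proof
  assume "addable P i (col n c) x"
  then have x: "x \<notin> col n c" "clr (fst x) = i" "young P (insert x (col n c))"
    by (simp_all add: addable_def block_color_def color)
  from add_cands_complete[OF codesD(1)[OF c] x(1)] x(2,3) obtain p c' d
    where p: "(p, c', d) \<in> set (add_cands i c)" "x = place n p" by (auto simp: young_def)
  note add = add_cands_col(1,2)[OF codesD(2,3)[OF c] p(1), of n] add_cands_col(3,4)[OF codesD(2,3)[OF c] p(1)]
  then have "c' \<in> set codes" using x(3) p(2) young_col_iff[OF add(3)] by simp
  then show "x \<in> place n ` fst ` set (within codes (add_cands i c))"
    using p by (force simp: within_iff)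
next
  assume "x \<in> place n ` fst ` set (within codes (add_cands i c))"
  then obtain p c' d where p: "(p, c', d) \<in> set (add_cands i c)" "c' \<in> set codes" "x = place n p"
    by (auto simp: within_iff)
  note add = add_cands_col(1,2)[OF codesD(2,3)[OF c] p(1), of n] add_cands_col(3,4)[OF codesD(2,3)[OF c] p(1)]
  then show "addable P i (col n c) x"
    using p young_col_iff[OF add(3)] by (simp add: addable_def block_color_place)
qed

lemma removable_col:
  assumes c: "c \<in> set codes"
  shows "removable P i (col n c) x \<longleftrightarrow> x \<in> place n ` fst ` set (within codes (del_cands i c))"
proof
  assume "removable P i (col n c) x"
  then have x: "x \<in> col n c" "clr (fst x) = i" "young P (col n c - {x})"
    by (simp_all add: removable_def block_color_def color)
  from del_cands_complete[OF codesD(1)[OF c] x(1)] x(2,3) obtain p c' d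
    where p: "(p, c', d) \<in> set (del_cands i c)" "x = place n p" by (auto simp: young_def)
  note del = del_cands_col(1,2)[OF codesD(2)[OF c] p(1), of n] del_cands_col(3,4)[OF codesD(2)[OF c] p(1)]
  then have "c' \<in> set codes" using x(3) p(2) young_col_iff[OF del(3)] by simp
  then show "x \<in> place n ` fst ` set (within codes (del_cands i c))"
    using p by (force simp: within_iff)
next
  assume "x \<in> place n ` fst ` set (within codes (del_cands i c))"
  then obtain p c' d where p: "(p, c', d) \<in> set (del_cands i c)" "c' \<in> set codes" "x = place n p"
    by (auto simp: within_iff)
  note del = del_cands_col(1,2)[OF codesD(2)[OF c] p(1), of n] del_cands_col(3,4)[OF codesD(2)[OF c] p(1)]
  then show "removable P i (col n c) x"
    using p young_col_iff[OF del(3)] by (simp add: removable_def block_color_place)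
qed

definition cls :: "'l code \<Rightarrow> 'l block set set" where
  "cls c = range (\<lambda>n. col n c)"

lemma shift_col: "shift k ` col n c = col (n + k) c"
proof -
  obtain A B where c: "c = (A, B)" by fastforce
  show ?thesis
  proof (intro set_eqI iffI)
    fix x assume "x \<in> col (n + k) c"
    then show "x \<in> shift k ` col n c"
      unfolding c by (intro image_eqI[of _ _ "(fst x, snd x - k)"]) (auto simp: shift_def)
  qed (auto simp: c shift_def)
qed

lemma column_class_col:
  assumes "c \<in> set codes"
  shows "column_class P (col n c) = cls c"
proof -
  have "\<exists>k. col m c = shift k ` col n c" for m by (rule exI[of _ "m - n"]) (simp add: shift_col)
  then show ?thesis using codesD(4)[OF assms]
    by (auto simp: column_class_def column_equiv_def cls_def shift_col)
qed

lemma cls_in_classes: "c \<in> set codes \<Longrightarrow> cls c \<in> column_classes P"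
  using column_class_col[of c 0] codesD(4)[of c 0]
  by (force simp: column_classes_def quotient_def column_class_def)

end

section \<open>Crystal operators and the energy function\<close>

lemma arg_max_eqI:
  fixes f :: "'a \<Rightarrow> 'b :: linorder"
  assumes "P x" "\<And>y. P y \<Longrightarrow> y \<noteq> x \<Longrightarrow> f y < f x"
  shows "arg_max f P = x"
  unfolding arg_max_def is_arg_max_def using assms by (intro some_equality) (auto dest: order.asym)

lemma arg_min_eqI:
  fixes f :: "'a \<Rightarrow> 'b :: linorder"
  assumes "P x" "\<And>y. P y \<Longrightarrow> y \<noteq> x \<Longrightarrow> f x < f y"
  shows "arg_min f P = x"
  unfolding arg_min_def is_arg_min_def using assms by (intro some_equality) (auto dest: order.asym)

lemma op_power_0: "op_power F 0 y = Some y"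
  by (simp add: op_power_def)

text \<open>Peels off the first application, as \<open>len\<close> does; this works because
  \<open>None\<close> is absorbing.\<close>

lemma op_power_Suc: "op_power F (Suc m) y = Option.bind (F y) (op_power F m)"
proof -
  have "((\<lambda>z. Option.bind z F) ^^ m) None = None" by (induction m) auto
  then show ?thesis unfolding op_power_def funpow_Suc_right by (cases "F y") auto
qed

text \<open>The fuel is not exhausted, so \<open>len\<close> is the true string length; it does not
  depend on the base \<open>n\<close>.\<close>

lemma op_power_defined_iff:
  assumes F: "\<And>n c. c \<in> C \<Longrightarrow> F (col n c) = map_option (\<lambda>(c', d). col (n + d) c') (g c)"
    and closed: "\<And>c c' d. c \<in> C \<Longrightarrow> g c = Some (c', d) \<Longrightarrow> c' \<in> C"
    and "c \<in> C" "len g k c < k"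
  shows "op_power F m (col n c) \<noteq> None \<longleftrightarrow> m \<le> len g k c"
  using assms(3,4)
proof (induction k arbitrary: c n m)
  case (Suc k)
  show ?case
  proof (cases m)
    case 0
    then show ?thesis by (simp add: op_power_0)
  next
    case (Suc m')
    show ?thesis
    proof (cases "g c")
      case None
      then show ?thesis using Suc F[OF Suc.prems(1)] by (simp add: op_power_Suc)
    next
      case (Some s)
      obtain c' d where s: "s = (c', d)" by fastforce
      have "c' \<in> C" "len g k c' < k" using closed[OF Suc.prems(1)] Suc.prems(2) Some s by auto
      from Suc.IH[OF this, of m' "n + d"] show ?thesis
        using Suc F[OF Suc.prems(1), of n] Some s by (simp add: op_power_Suc)
    qed
  qed
qed simp

lemma the_elem_image_const: "(\<And>x. x \<in> X \<Longrightarrow> h x = v) \<Longrightarrow> X \<noteq> {} \<Longrightarrow> the_elem (h ` X) = v"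
  by (metis (no_types, lifting) image_cong image_constant_conv the_elem_eq)

text \<open>Sets that both contain everything below \<open>K\<close> differ only above it, where
  they are finite and can be counted separately.\<close>

lemma card_Diff_ray:
  fixes S T :: "int set"
  assumes "{..<K} \<subseteq> S" "{..<K} \<subseteq> T" "finite (S \<inter> {K..})" "finite (T \<inter> {K..})"
  shows "int (card (S - T)) - int (card (T - S)) = int (card (S \<inter> {K..})) - int (card (T \<inter> {K..}))"
proof -
  have "S - T = (S \<inter> {K..}) - (T \<inter> {K..})" "T - S = (T \<inter> {K..}) - (S \<inter> {K..})"
    using assms(1,2) by (force simp: subset_iff not_less[symmetric])+
  then show ?thesis
    using card_Int_Diff[OF assms(3), of "T \<inter> {K..}"] card_Int_Diff[OF assms(4), of "S \<inter> {K..}"]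
    by (simp add: Int_commute)
qed

text \<open>The representatives of the \<open>y_r\<close> classes contain all blocks of index 0 and
  so have base 1; that of \<open>y_empty\<close> lacks the 0-block of index 0 and has base
  0.\<close>

locale crystal_pattern = layered_pattern letters sup0 sup1 clr lev P excs codes
  for letters :: "'l list" and sup0 sup1 clr lev P excs codes +
  fixes rs :: "(nat \<times> 'l code) list" and c0 :: "'l code" and z :: 'l
  assumes r_rep: "r_rep P j = map_option (col 1) (map_of rs j)"
    and rs: "distinct (map fst rs)" "snd ` set rs \<subseteq> set codes"
    and empty_rep: "empty_rep P = col 0 c0" and c0: "c0 \<in> set codes"
    and z: "clr l = 0 \<longleftrightarrow> l = z"
    and crystal_consistent: "crystal_consistent rs z codes"
begin

lemma y_empty: "y_empty P = cls c0"
  by (simp add: y_empty_def empty_rep column_class_col c0)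

lemma y_r:
  assumes "c \<in> set codes"
  shows "col n c \<in> y_r P j \<longleftrightarrow> (j, c) \<in> set rs"
proof (cases "map_of rs j")
  case None
  then have "(j, c) \<notin> set rs" by (force simp: map_of_eq_None_iff)
  then show ?thesis using None by (simp add: y_r_def r_rep)
next
  case (Some c')
  then have mem: "(j, c') \<in> set rs" by (rule map_of_SomeD)
  then have c': "c' \<in> set codes" using rs(2) by force
  have "col n c \<in> y_r P j \<longleftrightarrow> c = c'"
    using col_inj[OF codesD(2)[OF assms] codesD(2)[OF c']] Some
    by (auto simp: y_r_def r_rep column_class_col[OF c'] cls_def)
  then show ?thesis using mem rs(1) Some by (metis map_of_is_SomeI option.inject)
qed

section \<open>Crystal operators on codes and on classes\<close>

abbreviation phi :: "nat \<Rightarrow> 'l code \<Rightarrow> nat" where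
  "phi i c \<equiv> len (add_step rs codes i) 4 c"

abbreviation eps :: "nat \<Rightarrow> 'l code \<Rightarrow> nat" where
  "eps i c \<equiv> len (del_step rs codes i) 4 c"

lemma crystal_consistentD:
  assumes "c \<in> set codes" "i \<le> 4"
  shows "sorted_wrt (>) (map (rel_row \<circ> fst) (within codes (add_cands i c)))"
    "sorted_wrt (<) (map (rel_row \<circ> fst) (within codes (del_cands i c)))"
    "phi i c < 4" "eps i c < 4"
    "add_step rs codes i c = Some (c', d) \<Longrightarrow> weight z c' + d = weight z c + (if i = 0 then 1 else 0)"
proof -
  have "i \<in> set [0, 1, 2, 3, 4]" using assms(2) by auto
  then have *: "consistent_at rs z codes c i"
    using crystal_consistent assms(1)
    unfolding crystal_consistent_def consistent_code_def list_all_iff by blast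
  note * = *[unfolded consistent_at_def]
  then show "sorted_wrt (>) (map (rel_row \<circ> fst) (within codes (add_cands i c)))"
    "sorted_wrt (<) (map (rel_row \<circ> fst) (within codes (del_cands i c)))"
    "phi i c < 4" "eps i c < 4" by blast+
  show "weight z c' + d = weight z c + (if i = 0 then 1 else 0)" if "add_step rs codes i c = Some (c', d)"
    using * unfolding that by simp
qed

lemma blocked_iff:
  "c \<in> set codes \<Longrightarrow> (\<exists>j. j \<noteq> i \<and> col n c \<in> y_r P j) \<longleftrightarrow> list_ex (\<lambda>(j, c'). j \<noteq> i \<and> c' = c) rs"
  by (auto simp: y_r list_ex_iff)

lemma f_op_col:
  assumes "c \<in> set codes" "i \<le> 4"
  shows "f_op P i (col n c) = map_option (\<lambda>(c', d). col (n + d) c') (add_step rs codes i c)"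
proof (cases "within codes (add_cands i c)")
  case Nil
  then show ?thesis by (simp add: f_op_def addable_col[OF assms(1)] add_step_def step_def)
next
  case (Cons e t)
  obtain p c' d where e: "e = (p, c', d)" by (cases e) auto
  have mem: "(p, c', d) \<in> set (within codes (add_cands i c))" using Cons e by simp
  have "arg_max (row P) (addable P i (col n c)) = place n p"
  proof (rule arg_max_eqI)
    show "addable P i (col n c) (place n p)" using mem by (force simp: addable_col[OF assms(1)])
    fix y assume y: "addable P i (col n c) y" "y \<noteq> place n p"
    then show "row P y < row P (place n p)"
      using crystal_consistentD(1)[OF assms] Cons e by (auto simp: addable_col[OF assms(1)] row_place)
  qed
  moreover have "insert (place n p) (col n c) = col (n + d) c'"
    using add_cands_col(2)[OF codesD(2,3)[OF assms(1)], of p c' d i n] mem by (simp add: within_iff)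
  moreover have "\<exists>x. addable P i (col n c) x" using mem by (force simp: addable_col[OF assms(1)])
  ultimately show ?thesis
    using Cons e by (simp add: f_op_def blocked_iff[OF assms(1)] add_step_def step_def)
qed

lemma e_op_col:
  assumes "c \<in> set codes" "i \<le> 4"
  shows "e_op P i (col n c) = map_option (\<lambda>(c', d). col (n + d) c') (del_step rs codes i c)"
proof (cases "within codes (del_cands i c)")
  case Nil
  then show ?thesis by (simp add: e_op_def removable_col[OF assms(1)] del_step_def step_def)
next
  case (Cons e t)
  obtain p c' d where e: "e = (p, c', d)" by (cases e) auto
  have mem: "(p, c', d) \<in> set (within codes (del_cands i c))" using Cons e by simp
  have "arg_min (row P) (removable P i (col n c)) = place n p"
  proof (rule arg_min_eqI)
    show "removable P i (col n c) (place n p)" using mem by (force simp: removable_col[OF assms(1)])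
    fix y assume y: "removable P i (col n c) y" "y \<noteq> place n p"
    then show "row P (place n p) < row P y"
      using crystal_consistentD(2)[OF assms] Cons e by (auto simp: removable_col[OF assms(1)] row_place)
  qed
  moreover have "col n c - {place n p} = col (n + d) c'"
    using del_cands_col(2)[OF codesD(2)[OF assms(1)], of p c' d i n] mem by (simp add: within_iff)
  moreover have "\<exists>x. removable P i (col n c) x" using mem by (force simp: removable_col[OF assms(1)])
  ultimately show ?thesis
    using Cons e by (simp add: e_op_def blocked_iff[OF assms(1)] del_step_def step_def)
qed

lemma step_closed: "step rs codes cands i c = Some (c', d) \<Longrightarrow> c' \<in> set codes"
  by (auto simp: step_def within_eq split: if_splits list.splits dest: filter_eq_ConsD)

lemma phi_col:
  assumes "c \<in> set codes" "i \<le> 4"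
  shows "\<phi> P i (col n c) = phi i c"
proof -
  have "{m. op_power (f_op P i) m (col n c) \<noteq> None} = {..phi i c}"
    using op_power_defined_iff[of "set codes" "f_op P i" "add_step rs codes i" c 4 _ n]
      f_op_col[OF _ assms(2)] crystal_consistentD(3)[OF assms] assms(1) step_closed
    by (auto simp: add_step_def)
  moreover have "Max {..phi i c} = phi i c" by (rule Max_eqI) auto
  ultimately show ?thesis by (simp only: \<phi>_def)
qed

lemma eps_col:
  assumes "c \<in> set codes" "i \<le> 4"
  shows "\<epsilon> P i (col n c) = eps i c"
proof -
  have "{m. op_power (e_op P i) m (col n c) \<noteq> None} = {..eps i c}"
    using op_power_defined_iff[of "set codes" "e_op P i" "del_step rs codes i" c 4 _ n]
      e_op_col[OF _ assms(2)] crystal_consistentD(4)[OF assms] assms(1) step_closed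
    by (auto simp: del_step_def)
  moreover have "Max {..eps i c} = eps i c" by (rule Max_eqI) auto
  ultimately show ?thesis by (simp only: \<epsilon>_def)
qed

lemma class_ops:
  assumes "c \<in> set codes" "i \<le> 4"
  shows "\<phi>_class P i (cls c) = phi i c" "\<epsilon>_class P i (cls c) = eps i c"
    "f_class P i (cls c) = map_option (\<lambda>(c', d). cls c') (add_step rs codes i c)"
proof -
  show "\<phi>_class P i (cls c) = phi i c" "\<epsilon>_class P i (cls c) = eps i c"
    unfolding \<phi>_class_def \<epsilon>_class_def
    by (rule the_elem_image_const; auto simp: cls_def phi_col[OF assms] eps_col[OF assms])+
  have "map_option (column_class P) (f_op P i (col n c)) =
      map_option (\<lambda>(c', d). cls c') (add_step rs codes i c)" for n
  proof (cases "add_step rs codes i c")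
    case (Some s)
    obtain c' d where s: "s = (c', d)" by (cases s) blast
    then have "c' \<in> set codes" using Some by (auto simp: add_step_def intro: step_closed)
    then show ?thesis unfolding f_op_col[OF assms] Some s by (simp add: column_class_col)
  qed (simp add: f_op_col[OF assms])
  then show "f_class P i (cls c) = map_option (\<lambda>(c', d). cls c') (add_step rs codes i c)"
    unfolding f_class_def by (intro the_elem_image_const) (auto simp: cls_def)
qed

text \<open>
  \<open>H\<close> and the number of 0-blocks change by the same amount under the crystal operators, so the
  expression \<open>H(a \<otimes> b) + |a|\<^sub>0 - |b|\<^sub>0\<close> is invariant on pairs of actual columns.  On codes, where
  columns are only known up to a shift, it changes by the shifts.
\<close>

definition discrepancy :: "('l block set set \<times> 'l block set set \<Rightarrow> int) \<Rightarrow> 'l code \<Rightarrow> 'l code \<Rightarrow> int" where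
  "discrepancy H a b = H (cls a, cls b) + weight z a - weight z b"

lemma discrepancy_c0: "energy_function P H \<Longrightarrow> discrepancy H c0 c0 = 0"
  by (simp add: energy_function_def y_empty discrepancy_def)

text \<open>\<open>weight\<close> grows by 1 for \<open>i = 0\<close> and by 0 otherwise, less the
  shift \<open>d\<close>. The growth cancels against the change of \<open>H\<close>, and the shift
  remains. For the right factor all signs are reversed.\<close>

lemma discrepancy_left:
  assumes "energy_function P H" "a \<in> set codes" "b \<in> set codes" "i \<le> 4"
    and "eps i b < phi i a" "add_step rs codes i a = Some (a', d)"
  shows "discrepancy H a' b = discrepancy H a b - d"
proof -
  have "f_tensor P i (cls a, cls b) = Some (cls a', cls b)"
    using assms(5,6) by (simp add: f_tensor_def class_ops assms(2-4))
  then have "H (cls a', cls b) - H (cls a, cls b) = (if i \<noteq> 0 then 0 else - 1)"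
    using assms(1) cls_in_classes assms(2-5) class_ops(1,2)[of _ 0] unfolding energy_function_def
    by (smt (verit) atLeastAtMost_iff le0)
  then show ?thesis
    using crystal_consistentD(5)[OF assms(2,4,6)] by (simp add: discrepancy_def split: if_splits)
qed

lemma discrepancy_right:
  assumes "energy_function P H" "a \<in> set codes" "b \<in> set codes" "i \<le> 4"
    and "\<not> eps i b < phi i a" "add_step rs codes i b = Some (b', d)"
  shows "discrepancy H a b' = discrepancy H a b + d"
proof -
  have "f_tensor P i (cls a, cls b) = Some (cls a, cls b')"
    using assms(5,6) by (simp add: f_tensor_def class_ops assms(2-4))
  then have "H (cls a, cls b') - H (cls a, cls b) = (if i \<noteq> 0 then 0 else 1)"
    using assms(1) cls_in_classes assms(2-5) class_ops(1,2)[of _ 0] unfolding energy_function_def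
    by (smt (verit) atLeastAtMost_iff le0)
  then show ?thesis
    using crystal_consistentD(5)[OF assms(3,4,6)] by (simp add: discrepancy_def split: if_splits)
qed

text \<open>Each index carries exactly one 0-block. Below the smaller base \<open>K\<close> both
  columns are full, so both counts may be truncated at \<open>K\<close>.\<close>

lemma zero_count_col: "zero_count P (col k g) (col n c) = n + weight z c - (k + weight z g)"
proof -
  define S where "S n c = {m. (z, m) \<in> col n c}" for n c
  have count: "card {x \<in> y - y'. block_color P x = 0} = card ({m. (z, m) \<in> y} - {m. (z, m) \<in> y'})" for y y'
  proof -
    have "{x \<in> y - y'. block_color P x = 0} = Pair z ` ({m. (z, m) \<in> y} - {m. (z, m) \<in> y'})"
      by (auto simp: block_color_def color z)
    then show ?thesis by (simp add: card_image inj_on_def)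
  qed
  define K where "K = min k n"
  have S: "{..<K} \<subseteq> S n c \<and> finite (S n c \<inter> {K..}) \<and> int (card (S n c \<inter> {K..})) = n + weight z c - K"
    if "K \<le> n" for n c
  proof -
    obtain A B where c: "c = (A, B)" by fastforce
    define E where "E = (if z \<in> set A then {n} else {}) \<union> (if z \<in> set B then {n + 1} else {})"
    have *: "S n c \<inter> {K..} = {K..<n} \<union> E" using that by (auto simp: S_def c E_def)
    have "card ({K..<n} \<union> E) = card {K..<n} + card E"
      by (rule card_Un_disjoint) (auto simp: E_def)
    moreover have "int (card E) = weight z c" by (auto simp: E_def weight_def c)
    moreover have "finite E" by (auto simp: E_def)
    moreover have "{..<K} \<subseteq> S n c" using that by (auto simp: S_def c)
    ultimately show ?thesis using that * by simp
  qed
  have "zero_count P (col k g) (col n c) =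
      int (card (S n c - S k g)) - int (card (S k g - S n c))"
    unfolding zero_count_def count S_def ..
  also have "\<dots> = int (card (S n c \<inter> {K..})) - int (card (S k g \<inter> {K..}))"
    using S[of n c] S[of k g] by (intro card_Diff_ray) (auto simp: K_def)
  finally show ?thesis using S[of n c] S[of k g] by (simp add: K_def)
qed

end
section \<open>Pairs of columns\<close>

text \<open>The table \<open>info\<close> is compared with the operators once per state; the walks
  from all pairs then only look up entries and compare constructors instead of lists.\<close>

locale crystal_states = crystal_pattern letters sup0 sup1 clr lev P excs "map code states" rs "code s0" z
  for letters :: "'l list" and sup0 sup1 clr lev P excs rs z
    and code :: "'s \<Rightarrow> 'l code" and states :: "'s list" and s0 :: 's +
  fixes info :: "'s \<Rightarrow> (nat \<times> nat \<times> ('s \<times> nat) option) list" and fuel :: nat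
  assumes states: "set states = UNIV"
    and info: "\<forall>s\<in>set states. map (\<lambda>(p, q, f). (p, q, map_option (\<lambda>(t, d). (code t, int d)) f)) (info s) =
      map (\<lambda>i. (len (add_step rs (map code states) i) 4 (code s),
        len (del_step rs (map code states) i) 4 (code s), add_step rs (map code states) i (code s)))
      [1, 2, 3, 4, 0]"
    and walks: "\<forall>a\<in>set states. \<forall>b\<in>set states.
      case walk info s0 fuel a b 0 0 of None \<Rightarrow> False | Some (n, m) \<Rightarrow> contained (code a) (code b) n m"
begin

lemma code_in: "code s \<in> set (map code states)"
  by (simp add: states)

abbreviation disc where "disc H a b \<equiv> discrepancy H (code a) (code b)"

text \<open>The list \<open>is\<close> of colors is kept general because \<open>pick\<close> drops a
  color from both tables at each recursive call.\<close>

lemma pick_discrepancy: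
  assumes H: "energy_function P H"
    and "\<forall>i\<in>set is. i \<le> 4"
    and "map (\<lambda>(p, q, f). (p, q, map_option (\<lambda>(t, d). (code t, int d)) f)) as =
      map (\<lambda>i. (phi i (code a), eps i (code a), add_step rs (map code states) i (code a))) is"
    and "map (\<lambda>(p, q, f). (p, q, map_option (\<lambda>(t, d). (code t, int d)) f)) bs =
      map (\<lambda>i. (phi i (code b), eps i (code b), add_step rs (map code states) i (code b))) is"
    and "pick a b n m as bs = Some (a', b', n', m')"
  shows "disc H a' b' + int n' - int m' = disc H a b + int n - int m"
  using assms(2-)
proof (induction "is" arbitrary: as bs)
  case (Cons i "is")
  obtain p q fa as' where as: "as = (p, q, fa) # as'" "phi i (code a) = p"
    "add_step rs (map code states) i (code a) = map_option (\<lambda>(t, d). (code t, int d)) fa"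
    using Cons.prems(2) by (cases as) auto
  obtain p' q' fb bs' where bs: "bs = (p', q', fb) # bs'" "eps i (code b) = q'"
    "add_step rs (map code states) i (code b) = map_option (\<lambda>(t, d). (code t, int d)) fb"
    using Cons.prems(3) by (cases bs) auto
  have i: "i \<le> 4" using Cons.prems(1) by simp
  show ?case
  proof (cases "q' < p")
    case True
    then obtain d where "fa = Some (a', d)" "b' = b" "n' = d + n" "m' = m"
      using Cons.prems(4) as(1) bs(1) by (auto split: option.splits)
    then show ?thesis
      using discrepancy_left[OF H code_in code_in i, of b a] as bs True by simp
  next
    case False
    show ?thesis
    proof (cases fb)
      case None
      then show ?thesis using False Cons.IH[of as' bs'] Cons.prems as(1) bs(1) by simp
    next
      case (Some s)
      then obtain d where "fb = Some (b', d)" "a' = a" "n' = n" "m' = d + m"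
        using False Cons.prems(4) as(1) bs(1) by (cases s) auto
      then show ?thesis
        using discrepancy_right[OF H code_in code_in i, of b a] as bs False by simp
    qed
  qed
qed simp

lemma walk_discrepancy:
  assumes "energy_function P H" "walk info s0 k a b n m = Some (n', m')"
  shows "disc H a b + int n - int m = int n' - int m'"
  using assms(2)
proof (induction k arbitrary: a b n m)
  case (Suc k)
  show ?case
  proof (cases "a = s0 \<and> b = s0")
    case True
    then show ?thesis using Suc.prems discrepancy_c0[OF assms(1)] by simp
  next
    case False
    then obtain a1 b1 n1 m1 where p: "pick a b n m (info a) (info b) = Some (a1, b1, n1, m1)"
      and w: "walk info s0 k a1 b1 n1 m1 = Some (n', m')"
      using Suc.prems by (auto split: option.splits)
    have "disc H a1 b1 + int n1 - int m1 = disc H a b + int n - int m"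
      using pick_discrepancy[OF assms(1) _ info[rule_format] info[rule_format] p] states by simp
    then show ?thesis using Suc.IH[OF w] by simp
  qed
qed simp

lemma contained_subset:
  assumes "contained c c' n m"
  shows "col k c \<subseteq> col (k + (int n - int m)) c'"
proof -
  obtain A B A' B' where c: "c = (A, B)" "c' = (A', B')" by fastforce
  show ?thesis
  proof (cases "n = m \<or> n = Suc m")
    case True
    then show ?thesis using assms unfolding c by (auto split: if_splits)
  next
    case False
    then have "int n - int m \<ge> 2" using assms unfolding c by (auto split: if_splits)
    then show ?thesis unfolding c by auto
  qed
qed

theorem right_block:
  assumes H: "energy_function P H" and g: "g \<in> y_empty P" and Y: "young_wall P g Y"
    and red: "reduced P H g Y"
  shows "right_block_property Y"
proof -
  have "Y `` {Suc k} \<subseteq> Y `` {k}" for k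
  proof -
    have "\<exists>n s. Y `` {j} = col n (code s)" for j
    proof -
      have "young P (Y `` {j})" using Y by (simp add: young_wall_def)
      then obtain n c where "c \<in> set (map code states)" "Y `` {j} = col n c" by (rule young_code)
      moreover from this(1) obtain s where "c = code s" by auto
      ultimately show ?thesis by blast
    qed
    then obtain n1 a n0 b where a: "Y `` {Suc k} = col n1 (code a)" and b: "Y `` {k} = col n0 (code b)"
      by metis
    obtain k0 where g0: "g = col k0 (code s0)" using g by (auto simp: y_empty cls_def)
    have "H (cls (code a), cls (code b)) + (n1 + weight z (code a)) - (n0 + weight z (code b)) = 0"
      using red[unfolded reduced_def, rule_format, of k]
      by (simp add: a b g0 column_class_col[OF code_in] zero_count_col)
    \<comment> \<open>Being reduced fixes the relative height: the base of the right column exceeds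
      that of the left one by the discrepancy.\<close>
    then have eq: "n0 = n1 + disc H a b" by (simp add: discrepancy_def)
    have "case walk info s0 fuel a b 0 0 of None \<Rightarrow> False
        | Some (n, m) \<Rightarrow> contained (code a) (code b) n m"
      using walks states by simp
    then obtain n m where w: "walk info s0 fuel a b 0 0 = Some (n, m)"
      and c: "contained (code a) (code b) n m"
      by (cases "walk info s0 fuel a b 0 0") auto
    have "disc H a b = int n - int m" using walk_discrepancy[OF H w] by simp
    then show ?thesis using contained_subset[OF c, of n1] by (simp add: a b eq)
  qed
  then show ?thesis by (auto simp: right_block_property_def)
qed

end

section \<open>The columns of type \<open>E\<^sub>6\<^sup>(\<^sup>2\<^sup>)\<close>\<close>

definition e6_letters :: "e6_letter list" where
  "e6_letters = [Ed, Eb'', Ez, Ec', Ea', Eb', Eb, Ea, Ec]"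

fun e6_sup0 :: "e6_letter \<Rightarrow> e6_letter list" where
  "e6_sup0 Ec = []"
| "e6_sup0 Ea = []"
| "e6_sup0 Eb = [Ec]"
| "e6_sup0 Eb' = [Ec, Ea]"
| "e6_sup0 Ea' = [Eb]"
| "e6_sup0 Ec' = [Eb, Eb']"
| "e6_sup0 Ez = [Ea']"
| "e6_sup0 Eb'' = [Ea', Ec']"
| "e6_sup0 Ed = [Ec']"

fun e6_sup1 :: "e6_letter \<Rightarrow> e6_letter list" where
  "e6_sup1 Ec = [Eb'', Ed]"
| "e6_sup1 Ea = [Ez, Eb'']"
| "e6_sup1 Eb = []"
| "e6_sup1 Eb' = []"
| "e6_sup1 Ea' = []"
| "e6_sup1 Ec' = []"
| "e6_sup1 Ez = []"
| "e6_sup1 Eb'' = []"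
| "e6_sup1 Ed = []"

datatype e6_state =
  es0 | es1 | es2 | es3 | es4 | es5 | es6 | es7 | es8 | es9 | es10 | es11 | es12 | es13 | es14 |
  es15 | es16 | es17 | es18 | es19 | es20 | es21 | es22 | es23 | es24 | es25 | es26

definition e6_states :: "e6_state list" where
  "e6_states = [es0, es1, es2, es3, es4, es5, es6, es7, es8, es9, es10, es11, es12, es13, es14,
      es15, es16, es17, es18, es19, es20, es21, es22, es23, es24, es25, es26]"

fun e6_code :: "e6_state \<Rightarrow> e6_letter code" where
  "e6_code es0 = ([Ed, Eb'', Ec', Ea', Eb', Eb, Ea, Ec], [Ez, Ea', Eb, Ec])"
| "e6_code es1 = ([], [])"
| "e6_code es2 = ([Ec], [])"
| "e6_code es3 = ([Ea], [])"
| "e6_code es4 = ([Ea, Ec], [])"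
| "e6_code es5 = ([Eb, Ec], [])"
| "e6_code es6 = ([Eb', Ea, Ec], [])"
| "e6_code es7 = ([Ea', Eb, Ec], [])"
| "e6_code es8 = ([Eb', Eb, Ea, Ec], [])"
| "e6_code es9 = ([Ea', Eb, Ea, Ec], [])"
| "e6_code es10 = ([Ez, Ea', Eb, Ec], [])"
| "e6_code es11 = ([Ea', Eb', Eb, Ea, Ec], [])"
| "e6_code es12 = ([Ec', Eb', Eb, Ea, Ec], [])"
| "e6_code es13 = ([Ez, Ea', Eb, Ea, Ec], [])"
| "e6_code es14 = ([Ec', Ea', Eb', Eb, Ea, Ec], [])"
| "e6_code es15 = ([Ez, Ea', Eb', Eb, Ea, Ec], [])"
| "e6_code es16 = ([Ed, Ec', Eb', Eb, Ea, Ec], [])"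
| "e6_code es17 = ([Ez, Ec', Ea', Eb', Eb, Ea, Ec], [])"
| "e6_code es18 = ([Ed, Ec', Ea', Eb', Eb, Ea, Ec], [])"
| "e6_code es19 = ([Eb'', Ec', Ea', Eb', Eb, Ea, Ec], [])"
| "e6_code es20 = ([Ed, Ez, Ec', Ea', Eb', Eb, Ea, Ec], [])"
| "e6_code es21 = ([Eb'', Ez, Ec', Ea', Eb', Eb, Ea, Ec], [])"
| "e6_code es22 = ([Ed, Eb'', Ec', Ea', Eb', Eb, Ea, Ec], [])"
| "e6_code es23 = ([Ed, Eb'', Ec', Ea', Eb', Eb, Ea, Ec], [Ec])"
| "e6_code es24 = ([Eb'', Ez, Ec', Ea', Eb', Eb, Ea, Ec], [Ea])"
| "e6_code es25 = ([Ed, Eb'', Ec', Ea', Eb', Eb, Ea, Ec], [Eb, Ec])"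
| "e6_code es26 = ([Ed, Eb'', Ec', Ea', Eb', Eb, Ea, Ec], [Ea', Eb, Ec])"

fun e6_info :: "e6_state \<Rightarrow> (nat \<times> nat \<times> (e6_state \<times> nat) option)
    list" where
  "e6_info es0 = [(0, 0, None), (0, 0, None), (0, 0, None), (0, 0, None), (1, 1, Some (es10, 1))]"
| "e6_info es1 = [(1, 0, Some (es3, 0)), (0, 1, None), (1, 0, Some (es2, 0)),
      (0, 1, None), (0, 1, None)]"
| "e6_info es2 = [(1, 0, Some (es4, 0)), (1, 0, Some (es5, 0)), (0, 1, None),
      (0, 0, None), (0, 1, None)]"
| "e6_info es3 = [(0, 1, None), (0, 0, None), (1, 0, Some (es4, 0)), (0, 1, None), (0, 0, None)]"
| "e6_info es4 = [(0, 1, None), (2, 0, Some (es6, 0)), (0, 1, None), (0, 0, None), (0, 0, None)]"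
| "e6_info es5 = [(2, 0, Some (es7, 0)), (0, 1, None), (0, 0, None), (0, 0, None), (0, 1, None)]"
| "e6_info es6 = [(0, 0, None), (1, 1, Some (es8, 0)), (0, 0, None), (0, 0, None), (0, 0, None)]"
| "e6_info es7 = [(1, 1, Some (es9, 0)), (0, 0, None), (0, 0, None), (0, 0, None), (0, 0, None)]"
| "e6_info es8 = [(1, 0, Some (es11, 0)), (0, 2, None), (1, 0, Some (es12, 0)),
      (0, 0, None), (0, 0, None)]"
| "e6_info es9 = [(0, 2, None), (1, 0, Some (es11, 0)), (0, 0, None),
      (0, 0, None), (1, 0, Some (es13, 0))]"
| "e6_info es10 = [(1, 0, Some (es13, 0)), (0, 0, None), (0, 0, None), (0, 0, None), (0, 2, None)]"
| "e6_info es11 = [(0, 1, None), (0, 1, None), (1, 0, Some (es14, 0)),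
      (0, 0, None), (1, 0, Some (es15, 0))]"
| "e6_info es12 = [(1, 0, Some (es14, 0)), (0, 0, None), (0, 1, None),
      (1, 0, Some (es16, 0)), (0, 0, None)]"
| "e6_info es13 = [(0, 1, None), (1, 0, Some (es15, 0)), (0, 0, None), (0, 0, None), (0, 1, None)]"
| "e6_info es14 = [(0, 1, None), (1, 0, Some (es19, 0)), (0, 1, None),
      (1, 0, Some (es18, 0)), (1, 0, Some (es17, 0))]"
| "e6_info es15 = [(0, 0, None), (0, 1, None), (1, 0, Some (es17, 0)), (0, 0, None), (0, 1, None)]"
| "e6_info es16 = [(1, 0, Some (es18, 0)), (0, 0, None), (0, 0, None), (0, 1, None), (0, 0, None)]"
| "e6_info es17 = [(0, 0, None), (1, 0, Some (es21, 0)), (0, 1, None),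
      (1, 0, Some (es20, 0)), (0, 1, None)]"
| "e6_info es18 = [(0, 1, None), (1, 0, Some (es22, 0)), (0, 0, None),
      (0, 1, None), (1, 0, Some (es20, 0))]"
| "e6_info es19 = [(0, 0, None), (0, 1, None), (0, 0, None),
      (1, 0, Some (es22, 0)), (1, 0, Some (es21, 0))]"
| "e6_info es20 = [(0, 0, None), (1, 0, Some (es1, 1)), (0, 0, None), (0, 1, None), (0, 1, None)]"
| "e6_info es21 = [(1, 0, Some (es24, 0)), (0, 1, None), (0, 0, None),
      (1, 0, Some (es1, 1)), (0, 1, None)]"
| "e6_info es22 = [(0, 0, None), (0, 1, None), (1, 0, Some (es23, 0)),
      (0, 1, None), (1, 0, Some (es1, 1))]"
| "e6_info es23 = [(0, 0, None), (1, 0, Some (es25, 0)), (0, 1, None),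
      (0, 0, None), (1, 0, Some (es2, 1))]"
| "e6_info es24 = [(0, 1, None), (0, 0, None), (0, 0, None), (1, 0, Some (es3, 1)), (0, 0, None)]"
| "e6_info es25 = [(1, 0, Some (es26, 0)), (0, 1, None), (0, 0, None),
      (0, 0, None), (1, 0, Some (es5, 1))]"
| "e6_info es26 = [(0, 1, None), (0, 0, None), (0, 0, None), (0, 0, None), (2, 0, Some (es0, 0))]"

text \<open>\<open>Eb\<close> is the only block of the highest row, and \<open>Ea\<close> is free
  because nothing rests on it.\<close>

definition e6_exc :: "e6_letter code" where
  "e6_exc = ([Eb, Ea, Ec], [])"

text \<open>At the state listed with \<open>j\<close> all string lengths vanish except those of
  color \<open>j\<close>, which are both 1: an element of weight zero.\<close>

definition e6_rs :: "(nat \<times> e6_letter code) list" where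
  "e6_rs = [(1, e6_code es7), (2, e6_code es6)]"

lemma e6_states_UNIV: "set e6_states = UNIV"
proof (intro equalityI subsetI)
  fix s :: e6_state
  show "s \<in> set e6_states" by (cases s) (simp_all add: e6_states_def)
qed simp

lemma e6_letters_UNIV: "set e6_letters = UNIV"
proof (intro equalityI subsetI)
  fix l :: e6_letter
  show "l \<in> set e6_letters" by (cases l) (simp_all add: e6_letters_def)
qed simp

lemma e6_consistent:
  "layers.consistent e6_letters e6_sup0 e6_sup1 e6_color e6_level [e6_exc] (map e6_code e6_states)"
  by code_simp

lemma e6_crystal_consistent:
  "layers.crystal_consistent e6_letters e6_color e6_level e6_rs Ez (map e6_code e6_states)"
  by code_simp

lemma e6_info:
  "\<forall>s\<in>set e6_states. map (\<lambda>(p, q, f). (p, q, map_option (\<lambda>(t, d). (e6_code t, int d)) f)) (e6_info s) =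
    map (\<lambda>i.
     (len (layers.add_step e6_letters e6_color e6_rs (map e6_code e6_states) i) 4 (e6_code s),
      len (layers.del_step e6_letters e6_color e6_rs (map e6_code e6_states) i) 4 (e6_code s),
      layers.add_step e6_letters e6_color e6_rs (map e6_code e6_states) i (e6_code s)))
    [1, 2, 3, 4, 0]"
  by code_simp

text \<open>The fuel 80 only has to be large enough: exhausting it would give \<open>None\<close>,
  which the statement rejects.\<close>

lemma e6_walks:
  "\<forall>a\<in>set e6_states. \<forall>b\<in>set e6_states.
    case walk e6_info es0 80 a b 0 0 of None \<Rightarrow> False
    | Some (n, m) \<Rightarrow> contained (e6_code a) (e6_code b) n m"
  by code_simp

lemma e6_layered:
  "layered_pattern e6_letters e6_sup0 e6_sup1 e6_color e6_level e6_pattern [e6_exc]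
     (map e6_code e6_states)"
proof
  show "below e6_pattern l =
      (\<lambda>l'. (l', 0)) ` set (e6_sup0 l) \<union> (\<lambda>l'. (l', - 1)) ` set
          (e6_sup1 l)" for l
    by (cases l) (auto simp: e6_pattern_def)
qed (simp_all add: e6_pattern_def e6_letters_UNIV e6_consistent)

lemma e6_empty_rep: "empty_rep e6_pattern = col 0 (e6_code es0)"
proof (rule set_eqI)
  fix x :: "e6_letter block"
  show "x \<in> empty_rep e6_pattern \<longleftrightarrow> x \<in> col 0 (e6_code es0)"
    by (cases x; cases "fst x") (auto simp: e6_pattern_def e6_D_def)
qed

lemma e6_r_rep: "r_rep e6_pattern j = map_option (col 1) (map_of e6_rs j)"
proof -
  have eqs: "e6_D \<union> {(Ez, 0), (Ed, 0), (Ec, 1), (Eb, 1), (Ea', 1)} = col 1 (e6_code es7)"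
    "e6_D \<union> {(Ez, 0), (Ea, 1), (Eb', 1), (Ed, 0), (Ec, 1)} = col 1 (e6_code es6)"
  proof (rule_tac [!] set_eqI)
    fix x :: "e6_letter block"
    show "x \<in> e6_D \<union> {(Ez, 0), (Ed, 0), (Ec, 1), (Eb, 1), (Ea', 1)}
        \<longleftrightarrow> x \<in> col 1 (e6_code es7)"
      "x \<in> e6_D \<union> {(Ez, 0), (Ea, 1), (Eb', 1), (Ed, 0), (Ec, 1)}
          \<longleftrightarrow> x \<in> col 1 (e6_code es6)"
      by (cases x; cases "fst x"; auto simp: e6_D_def)+
  qed
  show ?thesis unfolding e6_pattern_def e6_rs_def pattern.select_convs eqs by simp
qed

lemma e6_crystal_states:
  "crystal_states e6_letters e6_sup0 e6_sup1 e6_color e6_level e6_pattern [e6_exc] e6_rs Ez e6_code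
     e6_states es0 e6_info 80"
proof -
  interpret layered_pattern e6_letters e6_sup0 e6_sup1 e6_color e6_level e6_pattern "[e6_exc]"
    "map e6_code e6_states"
    by (rule e6_layered)
  show ?thesis
  proof
    show "e6_color l = 0 \<longleftrightarrow> l = Ez" for l by (cases l) simp_all
    show "snd ` set e6_rs \<subseteq> set (map e6_code e6_states)"
      \<comment> \<open>Codes stay folded, so that membership follows from the states being all of
        the type.\<close>
      by (auto simp: e6_rs_def e6_states_UNIV simp del: e6_code.simps)
    show "distinct (map fst e6_rs)" by (simp add: e6_rs_def)
    show "e6_code es0 \<in> set (map e6_code e6_states)"
      by (simp add: e6_states_UNIV del: e6_code.simps)
  qed (rule e6_r_rep e6_empty_rep e6_states_UNIV e6_crystal_consistent e6_info e6_walks)+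
qed

section \<open>The columns of type \<open>F\<^sub>4\<^sup>(\<^sup>1\<^sup>)\<close>\<close>

text \<open>Inside the double-height row, \<open>Fb3\<close> and \<open>Fz\<close> precede the
  blocks of equal level on which they rest: the order follows the support relation, not just the
  rows.\<close>

definition f4_letters :: "f4_letter list" where
  "f4_letters = [Fb3, Fz, Fd2, Fc4, Fa2, Fc3, Fb2, Fb1, Fc2, Fa1, Fd1, Fc1]"

fun f4_sup0 :: "f4_letter \<Rightarrow> f4_letter list" where
  "f4_sup0 Fc1 = []"
| "f4_sup0 Fd1 = []"
| "f4_sup0 Fa1 = []"
| "f4_sup0 Fc2 = [Fc1, Fd1]"
| "f4_sup0 Fb1 = [Fc1, Fa1]"
| "f4_sup0 Fb2 = [Fc2]"
| "f4_sup0 Fc3 = [Fb1]"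
| "f4_sup0 Fa2 = [Fb2]"
| "f4_sup0 Fc4 = [Fb2, Fc3]"
| "f4_sup0 Fd2 = [Fc3]"
| "f4_sup0 Fz = [Fa2]"
| "f4_sup0 Fb3 = [Fa2, Fc4]"

fun f4_sup1 :: "f4_letter \<Rightarrow> f4_letter list" where
  "f4_sup1 Fc1 = [Fb3, Fc4, Fd2]"
| "f4_sup1 Fd1 = [Fc4, Fd2]"
| "f4_sup1 Fa1 = [Fz, Fb3]"
| "f4_sup1 Fc2 = []"
| "f4_sup1 Fb1 = []"
| "f4_sup1 Fb2 = []"
| "f4_sup1 Fc3 = []"
| "f4_sup1 Fa2 = []"
| "f4_sup1 Fc4 = []"
| "f4_sup1 Fd2 = []"
| "f4_sup1 Fz = []"
| "f4_sup1 Fb3 = []"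

datatype f4_state =
  fs0 | fs1 | fs2 | fs3 | fs4 | fs5 | fs6 | fs7 | fs8 | fs9 | fs10 | fs11 | fs12 | fs13 | fs14 |
  fs15 | fs16 | fs17 | fs18 | fs19 | fs20 | fs21 | fs22 | fs23 | fs24 | fs25 | fs26 | fs27 |
  fs28 | fs29 | fs30 | fs31 | fs32 | fs33 | fs34 | fs35 | fs36 | fs37 | fs38 | fs39 | fs40 |
  fs41 | fs42 | fs43 | fs44 | fs45 | fs46 | fs47 | fs48 | fs49 | fs50 | fs51 | fs52

definition f4_states :: "f4_state list" where
  "f4_states = [fs0, fs1, fs2, fs3, fs4, fs5, fs6, fs7, fs8, fs9, fs10, fs11, fs12, fs13, fs14,
      fs15, fs16, fs17, fs18, fs19, fs20, fs21, fs22, fs23, fs24, fs25, fs26, fs27, fs28, fs29,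
      fs30, fs31, fs32, fs33, fs34, fs35, fs36, fs37, fs38, fs39, fs40, fs41, fs42, fs43, fs44,
      fs45, fs46, fs47, fs48, fs49, fs50, fs51, fs52]"

fun f4_code :: "f4_state \<Rightarrow> f4_letter code" where
  "f4_code fs0 = ([Fb3, Fd2, Fc4, Fa2, Fc3, Fb2, Fb1, Fc2, Fa1, Fd1, Fc1], [Fz, Fa2, Fb2, Fc2,
      Fd1, Fc1])"
| "f4_code fs1 = ([], [])"
| "f4_code fs2 = ([Fd1], [])"
| "f4_code fs3 = ([Fa1], [])"
| "f4_code fs4 = ([Fc1], [])"
| "f4_code fs5 = ([Fa1, Fd1], [])"
| "f4_code fs6 = ([Fd1, Fc1], [])"
| "f4_code fs7 = ([Fa1, Fc1], [])"
| "f4_code fs8 = ([Fa1, Fd1, Fc1], [])"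
| "f4_code fs9 = ([Fc2, Fd1, Fc1], [])"
| "f4_code fs10 = ([Fb1, Fa1, Fc1], [])"
| "f4_code fs11 = ([Fc2, Fa1, Fd1, Fc1], [])"
| "f4_code fs12 = ([Fb1, Fa1, Fd1, Fc1], [])"
| "f4_code fs13 = ([Fb2, Fc2, Fd1, Fc1], [])"
| "f4_code fs14 = ([Fc3, Fb1, Fa1, Fc1], [])"
| "f4_code fs15 = ([Fb1, Fc2, Fa1, Fd1, Fc1], [])"
| "f4_code fs16 = ([Fc3, Fb1, Fa1, Fd1, Fc1], [])"
| "f4_code fs17 = ([Fa2, Fb2, Fc2, Fd1, Fc1], [])"
| "f4_code fs18 = ([Fd2, Fc3, Fb1, Fa1, Fc1], [])"
| "f4_code fs19 = ([Fb2, Fb1, Fc2, Fa1, Fd1, Fc1], [])"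
| "f4_code fs20 = ([Fc3, Fb1, Fc2, Fa1, Fd1, Fc1], [])"
| "f4_code fs21 = ([Fa2, Fb2, Fc2, Fa1, Fd1, Fc1], [])"
| "f4_code fs22 = ([Fd2, Fc3, Fb1, Fa1, Fd1, Fc1], [])"
| "f4_code fs23 = ([Fz, Fa2, Fb2, Fc2, Fd1, Fc1], [])"
| "f4_code fs24 = ([Fc3, Fb2, Fb1, Fc2, Fa1, Fd1, Fc1], [])"
| "f4_code fs25 = ([Fa2, Fb2, Fb1, Fc2, Fa1, Fd1, Fc1], [])"
| "f4_code fs26 = ([Fd2, Fc3, Fb1, Fc2, Fa1, Fd1, Fc1], [])"
| "f4_code fs27 = ([Fz, Fa2, Fb2, Fc2, Fa1, Fd1, Fc1], [])"
| "f4_code fs28 = ([Fa2, Fc3, Fb2, Fb1, Fc2, Fa1, Fd1, Fc1], [])"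
| "f4_code fs29 = ([Fd2, Fc3, Fb2, Fb1, Fc2, Fa1, Fd1, Fc1], [])"
| "f4_code fs30 = ([Fc4, Fc3, Fb2, Fb1, Fc2, Fa1, Fd1, Fc1], [])"
| "f4_code fs31 = ([Fz, Fa2, Fb2, Fb1, Fc2, Fa1, Fd1, Fc1], [])"
| "f4_code fs32 = ([Fd2, Fa2, Fc3, Fb2, Fb1, Fc2, Fa1, Fd1, Fc1], [])"
| "f4_code fs33 = ([Fz, Fa2, Fc3, Fb2, Fb1, Fc2, Fa1, Fd1, Fc1], [])"
| "f4_code fs34 = ([Fc4, Fa2, Fc3, Fb2, Fb1, Fc2, Fa1, Fd1, Fc1], [])"
| "f4_code fs35 = ([Fd2, Fc4, Fc3, Fb2, Fb1, Fc2, Fa1, Fd1, Fc1], [])"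
| "f4_code fs36 = ([Fz, Fd2, Fa2, Fc3, Fb2, Fb1, Fc2, Fa1, Fd1, Fc1], [])"
| "f4_code fs37 = ([Fd2, Fc4, Fa2, Fc3, Fb2, Fb1, Fc2, Fa1, Fd1, Fc1], [])"
| "f4_code fs38 = ([Fz, Fc4, Fa2, Fc3, Fb2, Fb1, Fc2, Fa1, Fd1, Fc1], [])"
| "f4_code fs39 = ([Fb3, Fc4, Fa2, Fc3, Fb2, Fb1, Fc2, Fa1, Fd1, Fc1], [])"
| "f4_code fs40 = ([Fd2, Fc4, Fc3, Fb2, Fb1, Fc2, Fa1, Fd1, Fc1], [Fd1])"
| "f4_code fs41 = ([Fz, Fd2, Fc4, Fa2, Fc3, Fb2, Fb1, Fc2, Fa1, Fd1, Fc1], [])"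
| "f4_code fs42 = ([Fb3, Fd2, Fc4, Fa2, Fc3, Fb2, Fb1, Fc2, Fa1, Fd1, Fc1], [])"
| "f4_code fs43 = ([Fb3, Fz, Fc4, Fa2, Fc3, Fb2, Fb1, Fc2, Fa1, Fd1, Fc1], [])"
| "f4_code fs44 = ([Fd2, Fc4, Fa2, Fc3, Fb2, Fb1, Fc2, Fa1, Fd1, Fc1], [Fd1])"
| "f4_code fs45 = ([Fz, Fd2, Fc4, Fa2, Fc3, Fb2, Fb1, Fc2, Fa1, Fd1, Fc1], [Fd1])"
| "f4_code fs46 = ([Fb3, Fd2, Fc4, Fa2, Fc3, Fb2, Fb1, Fc2, Fa1, Fd1, Fc1], [Fd1])"
| "f4_code fs47 = ([Fb3, Fz, Fc4, Fa2, Fc3, Fb2, Fb1, Fc2, Fa1, Fd1, Fc1], [Fa1])"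
| "f4_code fs48 = ([Fb3, Fd2, Fc4, Fa2, Fc3, Fb2, Fb1, Fc2, Fa1, Fd1, Fc1], [Fc1])"
| "f4_code fs49 = ([Fb3, Fd2, Fc4, Fa2, Fc3, Fb2, Fb1, Fc2, Fa1, Fd1, Fc1], [Fd1, Fc1])"
| "f4_code fs50 = ([Fb3, Fd2, Fc4, Fa2, Fc3, Fb2, Fb1, Fc2, Fa1, Fd1, Fc1], [Fc2, Fd1, Fc1])"
| "f4_code fs51 = ([Fb3, Fd2, Fc4, Fa2, Fc3, Fb2, Fb1, Fc2, Fa1, Fd1, Fc1], [Fb2, Fc2, Fd1, Fc1])"
| "f4_code fs52 = ([Fb3, Fd2, Fc4, Fa2, Fc3, Fb2, Fb1, Fc2, Fa1, Fd1, Fc1], [Fa2, Fb2, Fc2, Fd1,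
    Fc1])"

fun f4_info :: "f4_state \<Rightarrow> (nat \<times> nat \<times> (f4_state \<times> nat) option)
    list" where
  "f4_info fs0 = [(0, 0, None), (0, 0, None), (0, 0, None), (0, 0, None), (1, 1, Some (fs23, 1))]"
| "f4_info fs1 = [(1, 0, Some (fs3, 0)), (0, 1, None), (1, 0, Some (fs4, 0)),
      (1, 1, Some (fs2, 0)), (0, 1, None)]"
| "f4_info fs2 = [(1, 0, Some (fs5, 0)), (0, 1, None), (2, 0, Some (fs6, 0)),
      (0, 2, None), (0, 1, None)]"
| "f4_info fs3 = [(0, 1, None), (0, 0, None), (1, 0, Some (fs7, 0)),
      (1, 1, Some (fs5, 0)), (0, 0, None)]"
| "f4_info fs4 = [(1, 0, Some (fs7, 0)), (0, 0, None), (0, 1, None),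
      (1, 0, Some (fs6, 0)), (0, 1, None)]"
| "f4_info fs5 = [(0, 1, None), (0, 0, None), (2, 0, Some (fs8, 0)), (0, 2, None), (0, 0, None)]"
| "f4_info fs6 = [(1, 0, Some (fs8, 0)), (0, 0, None), (1, 1, Some (fs9, 0)),
      (0, 1, None), (0, 1, None)]"
| "f4_info fs7 = [(0, 1, None), (1, 0, Some (fs10, 0)), (0, 1, None),
      (1, 0, Some (fs8, 0)), (0, 0, None)]"
| "f4_info fs8 = [(0, 1, None), (1, 0, Some (fs12, 0)), (1, 1, Some (fs11, 0)),
      (0, 1, None), (0, 0, None)]"
| "f4_info fs9 = [(1, 0, Some (fs11, 0)), (1, 0, Some (fs13, 0)), (0, 2, None),
      (0, 0, None), (0, 1, None)]"
| "f4_info fs10 = [(0, 0, None), (0, 1, None), (1, 0, Some (fs14, 0)),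
      (1, 0, Some (fs12, 0)), (0, 0, None)]"
| "f4_info fs11 = [(0, 1, None), (2, 0, Some (fs15, 0)), (0, 2, None), (0, 0, None), (0, 0, None)]"
| "f4_info fs12 = [(0, 0, None), (0, 1, None), (2, 0, Some (fs16, 0)), (0, 1, None), (0, 0, None)]"
| "f4_info fs13 = [(2, 0, Some (fs17, 0)), (0, 1, None), (0, 0, None), (0, 0, None), (0, 1, None)]"
| "f4_info fs14 = [(0, 0, None), (0, 0, None), (0, 1, None), (2, 0, Some (fs18, 0)), (0, 0, None)]"
| "f4_info fs15 = [(0, 0, None), (1, 1, Some (fs19, 0)), (0, 0, None), (0, 0, None), (0, 0, None)]"
| "f4_info fs16 = [(0, 0, None), (0, 0, None), (1, 1, Some (fs20, 0)), (0, 0, None), (0, 0, None)]"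
| "f4_info fs17 = [(1, 1, Some (fs21, 0)), (0, 0, None), (0, 0, None), (0, 0, None), (0, 0, None)]"
| "f4_info fs18 = [(0, 0, None), (0, 0, None), (0, 0, None), (1, 1, Some (fs22, 0)), (0, 0, None)]"
| "f4_info fs19 = [(1, 0, Some (fs25, 0)), (0, 2, None), (2, 0, Some (fs24, 0)),
      (0, 0, None), (0, 0, None)]"
| "f4_info fs20 = [(0, 0, None), (1, 0, Some (fs24, 0)), (0, 2, None),
      (1, 0, Some (fs26, 0)), (0, 0, None)]"
| "f4_info fs21 = [(0, 2, None), (1, 0, Some (fs25, 0)), (0, 0, None),
      (0, 0, None), (1, 0, Some (fs27, 0))]"
| "f4_info fs22 = [(0, 0, None), (0, 0, None), (1, 0, Some (fs26, 0)), (0, 2, None), (0, 0, None)]"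
| "f4_info fs23 = [(1, 0, Some (fs27, 0)), (0, 0, None), (0, 0, None), (0, 0, None), (0, 2, None)]"
| "f4_info fs24 = [(1, 0, Some (fs28, 0)), (0, 1, None), (1, 1, Some (fs30, 0)),
      (1, 0, Some (fs29, 0)), (0, 0, None)]"
| "f4_info fs25 = [(0, 1, None), (0, 1, None), (2, 0, Some (fs28, 0)),
      (0, 0, None), (1, 0, Some (fs31, 0))]"
| "f4_info fs26 = [(0, 0, None), (1, 0, Some (fs29, 0)), (0, 1, None), (0, 1, None), (0, 0, None)]"
| "f4_info fs27 = [(0, 1, None), (1, 0, Some (fs31, 0)), (0, 0, None), (0, 0, None), (0, 1, None)]"
| "f4_info fs28 = [(0, 1, None), (0, 0, None), (1, 1, Some (fs34, 0)),
      (1, 0, Some (fs32, 0)), (1, 0, Some (fs33, 0))]"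
| "f4_info fs29 = [(1, 0, Some (fs32, 0)), (0, 1, None), (1, 0, Some (fs35, 0)),
      (0, 1, None), (0, 0, None)]"
| "f4_info fs30 = [(1, 0, Some (fs34, 0)), (0, 0, None), (0, 2, None),
      (2, 0, Some (fs35, 0)), (0, 0, None)]"
| "f4_info fs31 = [(0, 0, None), (0, 1, None), (2, 0, Some (fs33, 0)), (0, 0, None), (0, 1, None)]"
| "f4_info fs32 = [(0, 1, None), (0, 0, None), (1, 0, Some (fs37, 0)),
      (0, 1, None), (1, 0, Some (fs36, 0))]"
| "f4_info fs33 = [(0, 0, None), (0, 0, None), (1, 1, Some (fs38, 0)),
      (1, 0, Some (fs36, 0)), (0, 1, None)]"
| "f4_info fs34 = [(0, 1, None), (1, 0, Some (fs39, 0)), (0, 2, None),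
      (2, 0, Some (fs37, 0)), (1, 0, Some (fs38, 0))]"
| "f4_info fs35 = [(1, 0, Some (fs37, 0)), (0, 0, None), (0, 1, None),
      (1, 1, Some (fs40, 0)), (0, 0, None)]"
| "f4_info fs36 = [(0, 0, None), (0, 0, None), (1, 0, Some (fs41, 0)), (0, 1, None), (0, 1, None)]"
| "f4_info fs37 = [(0, 1, None), (1, 0, Some (fs42, 0)), (0, 1, None),
      (1, 1, Some (fs44, 0)), (1, 0, Some (fs41, 0))]"
| "f4_info fs38 = [(0, 0, None), (1, 0, Some (fs43, 0)), (0, 2, None),
      (2, 0, Some (fs41, 0)), (0, 1, None)]"
| "f4_info fs39 = [(0, 0, None), (0, 1, None), (0, 0, None),
      (2, 0, Some (fs42, 0)), (1, 0, Some (fs43, 0))]"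
| "f4_info fs40 = [(1, 0, Some (fs44, 0)), (0, 0, None), (0, 0, None), (0, 2, None), (0, 0, None)]"
| "f4_info fs41 = [(0, 0, None), (1, 0, Some (fs1, 1)), (0, 1, None),
      (1, 1, Some (fs45, 0)), (0, 1, None)]"
| "f4_info fs42 = [(0, 0, None), (0, 1, None), (1, 0, Some (fs48, 0)),
      (1, 1, Some (fs46, 0)), (1, 0, Some (fs1, 1))]"
| "f4_info fs43 = [(1, 0, Some (fs47, 0)), (0, 1, None), (0, 0, None),
      (2, 0, Some (fs1, 1)), (0, 1, None)]"
| "f4_info fs44 = [(0, 1, None), (1, 0, Some (fs46, 0)), (0, 0, None),
      (0, 2, None), (1, 0, Some (fs45, 0))]"
| "f4_info fs45 = [(0, 0, None), (1, 0, Some (fs2, 1)), (0, 0, None), (0, 2, None), (0, 1, None)]"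
| "f4_info fs46 = [(0, 0, None), (0, 1, None), (2, 0, Some (fs49, 0)),
      (0, 2, None), (1, 0, Some (fs2, 1))]"
| "f4_info fs47 = [(0, 1, None), (0, 0, None), (0, 0, None), (2, 0, Some (fs3, 1)), (0, 0, None)]"
| "f4_info fs48 = [(0, 0, None), (0, 0, None), (0, 1, None),
      (1, 0, Some (fs49, 0)), (1, 0, Some (fs4, 1))]"
| "f4_info fs49 = [(0, 0, None), (0, 0, None), (1, 1, Some (fs50, 0)),
      (0, 1, None), (1, 0, Some (fs6, 1))]"
| "f4_info fs50 = [(0, 0, None), (1, 0, Some (fs51, 0)), (0, 2, None),
      (0, 0, None), (1, 0, Some (fs9, 1))]"
| "f4_info fs51 = [(1, 0, Some (fs52, 0)), (0, 1, None), (0, 0, None),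
      (0, 0, None), (1, 0, Some (fs13, 1))]"
| "f4_info fs52 = [(0, 1, None), (0, 0, None), (0, 0, None), (0, 0, None), (2, 0, Some (fs0, 0))]"

text \<open>Here \<open>Fb2\<close> is alone in the highest row, and \<open>Fa1\<close> is free
  because \<open>Fb1\<close> is absent.\<close>

definition f4_exc :: "f4_letter code" where
  "f4_exc = ([Fb2, Fc2, Fa1, Fd1, Fc1], [])"

text \<open>All four colors occur, one for each zero-weight element of the 52-dimensional adjoint
  representation.\<close>

definition f4_rs :: "(nat \<times> f4_letter code) list" where
  "f4_rs = [(1, f4_code fs17), (2, f4_code fs15), (3, f4_code fs16), (4, f4_code fs18)]"

lemma f4_states_UNIV: "set f4_states = UNIV"
proof (intro equalityI subsetI)
  fix s :: f4_state
  show "s \<in> set f4_states" by (cases s) (simp_all add: f4_states_def)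
qed simp

lemma f4_letters_UNIV: "set f4_letters = UNIV"
proof (intro equalityI subsetI)
  fix l :: f4_letter
  show "l \<in> set f4_letters" by (cases l) (simp_all add: f4_letters_def)
qed simp

lemma f4_consistent:
  "layers.consistent f4_letters f4_sup0 f4_sup1 f4_color f4_level [f4_exc] (map f4_code f4_states)"
  by code_simp

lemma f4_crystal_consistent:
  "layers.crystal_consistent f4_letters f4_color f4_level f4_rs Fz (map f4_code f4_states)"
  by code_simp

lemma f4_info:
  "\<forall>s\<in>set f4_states. map (\<lambda>(p, q, f). (p, q, map_option (\<lambda>(t, d). (f4_code t, int d)) f)) (f4_info s) =
    map (\<lambda>i.
     (len (layers.add_step f4_letters f4_color f4_rs (map f4_code f4_states) i) 4 (f4_code s),
      len (layers.del_step f4_letters f4_color f4_rs (map f4_code f4_states) i) 4 (f4_code s),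
      layers.add_step f4_letters f4_color f4_rs (map f4_code f4_states) i (f4_code s)))
    [1, 2, 3, 4, 0]"
  by code_simp

lemma f4_walks:
  "\<forall>a\<in>set f4_states. \<forall>b\<in>set f4_states.
    case walk f4_info fs0 80 a b 0 0 of None \<Rightarrow> False
    | Some (n, m) \<Rightarrow> contained (f4_code a) (f4_code b) n m"
  by code_simp

lemma f4_layered:
  "layered_pattern f4_letters f4_sup0 f4_sup1 f4_color f4_level f4_pattern [f4_exc]
     (map f4_code f4_states)"
proof
  show "below f4_pattern l =
      (\<lambda>l'. (l', 0)) ` set (f4_sup0 l) \<union> (\<lambda>l'. (l', - 1)) ` set
          (f4_sup1 l)" for l
    by (cases l) (auto simp: f4_pattern_def)
qed (simp_all add: f4_pattern_def f4_letters_UNIV f4_consistent)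

lemma f4_empty_rep: "empty_rep f4_pattern = col 0 (f4_code fs0)"
proof (rule set_eqI)
  fix x :: "f4_letter block"
  show "x \<in> empty_rep f4_pattern \<longleftrightarrow> x \<in> col 0 (f4_code fs0)"
    by (cases x; cases "fst x") (auto simp: f4_pattern_def f4_D_def)
qed

lemma f4_r_rep: "r_rep f4_pattern j = map_option (col 1) (map_of f4_rs j)"
proof -
  have eqs: "f4_D \<union> {(Fz, 0), (Fd2, 0), (Fc1, 1), (Fd1, 1), (Fc2, 1), (Fb2, 1), (Fa2, 1)}
      = col 1 (f4_code fs17)"
    "f4_D \<union> {(Fz, 0), (Fa1, 1), (Fb1, 1), (Fd2, 0), (Fc1, 1), (Fd1, 1), (Fc2, 1)} = col
        1 (f4_code fs15)"
    "f4_D \<union> {(Fz, 0), (Fa1, 1), (Fb1, 1), (Fc3, 1), (Fd2, 0), (Fc1, 1), (Fd1, 1)} = col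
        1 (f4_code fs16)"
    "f4_D \<union> {(Fz, 0), (Fa1, 1), (Fb1, 1), (Fc3, 1), (Fd2, 1), (Fd2, 0), (Fc1, 1)} = col
        1 (f4_code fs18)"
  proof (rule_tac [!] set_eqI)
    fix x :: "f4_letter block"
    show "x \<in> f4_D \<union> {(Fz, 0), (Fd2, 0), (Fc1, 1), (Fd1, 1), (Fc2, 1), (Fb2, 1),
        (Fa2, 1)} \<longleftrightarrow> x \<in> col 1 (f4_code fs17)"
      "x \<in> f4_D \<union> {(Fz, 0), (Fa1, 1), (Fb1, 1), (Fd2, 0), (Fc1, 1), (Fd1, 1),
          (Fc2, 1)} \<longleftrightarrow> x \<in> col 1 (f4_code fs15)"
      "x \<in> f4_D \<union> {(Fz, 0), (Fa1, 1), (Fb1, 1), (Fc3, 1), (Fd2, 0), (Fc1, 1),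
          (Fd1, 1)} \<longleftrightarrow> x \<in> col 1 (f4_code fs16)"
      "x \<in> f4_D \<union> {(Fz, 0), (Fa1, 1), (Fb1, 1), (Fc3, 1), (Fd2, 1), (Fd2, 0),
          (Fc1, 1)} \<longleftrightarrow> x \<in> col 1 (f4_code fs18)"
      by (cases x; cases "fst x"; auto simp: f4_D_def)+
  qed
  show ?thesis unfolding f4_pattern_def f4_rs_def pattern.select_convs eqs by simp
qed

lemma f4_crystal_states:
  "crystal_states f4_letters f4_sup0 f4_sup1 f4_color f4_level f4_pattern [f4_exc] f4_rs Fz f4_code
     f4_states fs0 f4_info 80"
proof -
  interpret layered_pattern f4_letters f4_sup0 f4_sup1 f4_color f4_level f4_pattern "[f4_exc]"
    "map f4_code f4_states"
    by (rule f4_layered)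
  show ?thesis
  proof
    show "f4_color l = 0 \<longleftrightarrow> l = Fz" for l by (cases l) simp_all
    show "snd ` set f4_rs \<subseteq> set (map f4_code f4_states)"
      by (auto simp: f4_rs_def f4_states_UNIV simp del: f4_code.simps)
    show "distinct (map fst f4_rs)" by (simp add: f4_rs_def)
    show "f4_code fs0 \<in> set (map f4_code f4_states)"
      by (simp add: f4_states_UNIV del: f4_code.simps)
  qed (rule f4_r_rep f4_empty_rep f4_states_UNIV f4_crystal_consistent f4_info f4_walks)+
qed

theorem proposition4p3:
  shows "(\<forall>H g Y. energy_function e6_pattern H \<longrightarrow> g \<in> y_empty e6_pattern \<longrightarrow>
            young_wall e6_pattern g Y \<longrightarrow> reduced e6_pattern H g Y \<longrightarrow> right_block_property Y)
       \<and> (\<forall>H' g Y. energy_function f4_pattern H' \<longrightarrow> g \<in> y_empty f4_pattern \<longrightarrow>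
            young_wall f4_pattern g Y \<longrightarrow> reduced f4_pattern H' g Y \<longrightarrow> right_block_property Y)"
  using crystal_states.right_block[OF e6_crystal_states] crystal_states.right_block[OF f4_crystal_states]
  by blast

end
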